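(* Let $n_1,n_2,n_3\in\mathbb{N}_0$, let $\alpha,\beta,\gamma,\delta,a,b$ be real parameters, and put $n=n_1+n_2+n_3$, $e=\alpha+\beta+\gamma+\delta+a+b$. Write $u=P_{n_1,n_2,n_3}^{(\alpha,\beta,\gamma,\delta,a,b)}(x,y,z)$ for the six-parameter polynomial in the context, and let $\mathcal{N}_{0,i},\mathcal{N}_{0,i}^+,\mathcal{N}_{i,0},\mathcal{N}_{i,0}^+,\mathcal{O}_{i,0},\mathcal{O}_{i,0}^+$ ($1\le i\le 6$) be the differential operators in the context, formed with these same values of $n_1,n_2,n_3,\alpha,\beta,\gamma,\delta,a,b$. Then the following 36 relations hold (all polynomials evaluated at $(x,y,z)$). First set: $$\mathcal{N}_{0,1}u=(n_2+2n_3+\beta+\gamma+\delta+b+2)\,P_{n_1,n_2-1,n_3}^{(\alpha,\beta+1,\gamma,\delta,a,b+1)},$$ $$\mathcal{N}_{0,1}^{+}u=(n_2+1)\,P_{n_1,n_2+1,n_3}^{(\alpha,\beta-1,\gamma,\delta,a,b-1)},$$ $$\mathcal{N}_{0,2}u=(n_2+2n_3+\beta+\gamma+\delta+b+2)\,P_{n_1,n_2,n_3}^{(\alpha,\beta,\gamma,\delta,a-1,b+1)},$$ $$\mathcal{N}_{0,2}^{+}u=(n_2+2n_3+\gamma+\delta+b+1)\,P_{n_1,n_2,n_3}^{(\alpha,\beta,\gamma,\delta,a+1,b-1)},$$ $$\mathcal{N}_{0,3}u=(n_2+2n_3+\beta+\gamma+\delta+b+2)\,P_{n_1,n_2,n_3}^{(\alpha,\beta+1,\gamma,\delta,a-1,b)},$$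 $$\mathcal{N}_{0,3}^{+}u=(n_2+\beta)\,P_{n_1,n_2,n_3}^{(\alpha,\beta-1,\gamma,\delta,a+1,b)},$$ $$\mathcal{N}_{0,4}u=(n_2+1)\,P_{n_1,n_2+1,n_3}^{(\alpha,\beta,\gamma,\delta,a-1,b-1)},$$ $$\mathcal{N}_{0,4}^{+}u=(n_2+\beta)\,P_{n_1,n_2-1,n_3}^{(\alpha,\beta,\gamma,\delta,a+1,b+1)},$$ $$\mathcal{N}_{0,5}u=(n_2+1)\,P_{n_1,n_2+1,n_3}^{(\alpha,\beta-1,\gamma,\delta,a-1,b)},$$ $$\mathcal{N}_{0,5}^{+}u=(n_2+2n_3+\gamma+\delta+b+1)\,P_{n_1,n_2-1,n_3}^{(\alpha,\beta+1,\gamma,\delta,a+1,b)},$$ $$\mathcal{N}_{0,6}u=(n_2+\beta)\,P_{n_1,n_2,n_3}^{(\alpha,\beta-1,\gamma,\delta,a,b+1)},$$ $$\mathcal{N}_{0,6}^{+}u=(n_2+2n_3+\gamma+\delta+b+1)\,P_{n_1,n_2,n_3}^{(\alpha,\beta+1,\gamma,\delta,a,b-1)}.$$ Second set: $$\mathcal{N}_{1,0}u=(n+n_2+n_3+e+3)\,P_{n_1-1,n_2,n_3}^{(\alpha+1,\beta,\gamma,\delta,a+1,b)},$$ $$\mathcal{N}_{1,0}^{+}u=(n_1+1)\,P_{n_1+1,n_2,n_3}^{(\alpha-1,\beta,\gamma,\delta,a-1,b)},$$ $$\mathcal{N}_{2,0}u=(n+n_2+n_3+e+3)\,P_{n_1,n_2,n_3}^{(\alpha,\beta,\gamma,\delta,a+1,b)},$$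 $$\mathcal{N}_{2,0}^{+}u=(n+n_2+n_3+e-\alpha+2)\,P_{n_1,n_2,n_3}^{(\alpha,\beta,\gamma,\delta,a-1,b)},$$ $$\mathcal{N}_{3,0}u=(n+n_2+n_3+e+3)\,P_{n_1,n_2,n_3}^{(\alpha+1,\beta,\gamma,\delta,a,b)},$$ $$\mathcal{N}_{3,0}^{+}u=(n_1+\alpha)\,P_{n_1,n_2,n_3}^{(\alpha-1,\beta,\gamma,\delta,a,b)},$$ $$\mathcal{N}_{4,0}u=(n_1+1)\,P_{n_1+1,n_2,n_3}^{(\alpha,\beta,\gamma,\delta,a-1,b)},$$ $$\mathcal{N}_{4,0}^{+}u=(n_1+\alpha)\,P_{n_1-1,n_2,n_3}^{(\alpha,\beta,\gamma,\delta,a+1,b)},$$ $$\mathcal{N}_{5,0}u=(n_1+1)\,P_{n_1+1,n_2,n_3}^{(\alpha-1,\beta,\gamma,\delta,a,b)},$$ $$\mathcal{N}_{5,0}^{+}u=(n+n_2+n_3+e-\alpha+2)\,P_{n_1-1,n_2,n_3}^{(\alpha+1,\beta,\gamma,\delta,a,b)},$$ $$\mathcal{N}_{6,0}u=(n_1+\alpha)\,P_{n_1,n_2,n_3}^{(\alpha-1,\beta,\gamma,\delta,a+1,b)},$$ $$\mathcal{N}_{6,0}^{+}u=(n+n_2+n_3+e-\alpha+2)\,P_{n_1,n_2,n_3}^{(\alpha+1,\beta,\gamma,\delta,a-1,b)}.$$ Third set: $$\mathcal{O}_{1,0}u=(n_3+\delta+\gamma+1)\,P_{n_1,n_2,n_3-1}^{(\alpha,\beta,\gamma+1,\delta+1,a,b)},$$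 $$\mathcal{O}_{1,0}^{+}u=(n_3+1)\,P_{n_1,n_2,n_3+1}^{(\alpha,\beta,\gamma-1,\delta-1,a,b)},$$ $$\mathcal{O}_{2,0}u=(n_3+\delta+\gamma+1)\,P_{n_1,n_2,n_3}^{(\alpha,\beta,\gamma,\delta+1,a,b-1)},$$ $$\mathcal{O}_{2,0}^{+}u=(n_3+\delta)\,P_{n_1,n_2,n_3}^{(\alpha,\beta,\gamma,\delta-1,a,b+1)},$$ $$\mathcal{O}_{3,0}u=(n_3+\delta+\gamma+1)\,P_{n_1,n_2,n_3}^{(\alpha,\beta,\gamma+1,\delta,a,b-1)},$$ $$\mathcal{O}_{3,0}^{+}u=(n_3+\gamma)\,P_{n_1,n_2,n_3}^{(\alpha,\beta,\gamma-1,\delta,a,b+1)},$$ $$\mathcal{O}_{4,0}u=(n_3+1)\,P_{n_1,n_2,n_3+1}^{(\alpha,\beta,\gamma,\delta-1,a,b-1)},$$ $$\mathcal{O}_{4,0}^{+}u=(n_3+\gamma)\,P_{n_1,n_2,n_3-1}^{(\alpha,\beta,\gamma,\delta+1,a,b+1)},$$ $$\mathcal{O}_{5,0}u=(n_3+1)\,P_{n_1,n_2,n_3+1}^{(\alpha,\beta,\gamma-1,\delta,a,b-1)},$$ $$\mathcal{O}_{5,0}^{+}u=(n_3+\delta)\,P_{n_1,n_2,n_3-1}^{(\alpha,\beta,\gamma+1,\delta,a,b+1)},$$ $$\mathcal{O}_{6,0}u=(n_3+\gamma)\,P_{n_1,n_2,n_3}^{(\alpha,\beta,\gamma-1,\delta+1,a,b)},$$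 $$\mathcal{O}_{6,0}^{+}u=(n_3+\delta)\,P_{n_1,n_2,n_3}^{(\alpha,\beta,\gamma+1,\delta-1,a,b)}.$$
   Context: Jacobi polynomials: for $n\in\mathbb{N}_0=\{0,1,2,\dots\}$ and real $p,q$, $$P_n^{(p,q)}(t)=\frac{(-1)^n}{2^n n!}(1-t)^{-p}(1+t)^{-q}\frac{d^n}{dt^n}\left\{(1-t)^{n+p}(1+t)^{n+q}\right\}$$ (a polynomial in $t$). Everything is considered on the simplex $\mathbb{T}^3=\{(x,y,z)\in\mathbb{R}^3: x,y,z>0,\ 1-x-y-z>0\}$. Six-parameter polynomials: for $n_1,n_2,n_3\in\mathbb{N}_0$, $$P_{n_1,n_2,n_3}^{(\alpha,\beta,\gamma,\delta,a,b)}(x,y,z)=P_{n_1}^{(\beta+\gamma+\delta+a+b+2n_2+2n_3+2,\,\alpha)}(2x-1)\,(1-x)^{n_2}\,P_{n_2}^{(\gamma+\delta+2n_3+b+1,\,\beta)}\!\left(\tfrac{2y}{1-x}-1\right)(1-x-y)^{n_3}\,P_{n_3}^{(\delta,\gamma)}\!\left(\tfrac{2z}{1-x-y}-1\right).$$ A polynomial with a negative index is zero by convention. Operators. Put $n=n_1+n_2+n_3$, $e=\alpha+\beta+\gamma+\delta+a+b$, $w=1-x-y-z$; subscripts on $u$ are partial derivatives. $\mathcal{N}_{0,1}u=\frac{n_3}{1-x-y}u+u_y-\frac{z}{1-x-y}u_z$, $\mathcal{N}_{0,1}^{+}u=\left(y(\gamma+\delta+n_3+b+1)-(1-x-y)\beta\right)u-y(1-x-y)u_y+yz\,u_z$,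 $\mathcal{N}_{0,2}u=(n_2+2n_3+\beta+\gamma+\delta+b+2)u+\frac{n_3y}{1-x-y}u+y\,u_y-\frac{yz}{1-x-y}u_z$, $\mathcal{N}_{0,2}^{+}u=(n_2+2n_3+\gamma+\delta+b+1)u-\frac{(n_2+n_3)y}{1-x}u-\frac{y(1-x-y)}{1-x}u_y+\frac{yz}{1-x}u_z$, $\mathcal{N}_{0,3}u=(n_2+n_3+\beta+\gamma+\delta+b+2)u-(1-x-y)u_y+z\,u_z$, $\mathcal{N}_{0,3}^{+}u=\left(\beta+\frac{n_2+n_3}{1-x}y\right)u+\frac{y(1-x-y)}{1-x}u_y-\frac{yz}{1-x}u_z$, $\mathcal{N}_{0,4}u=\left(y(n_3+\gamma+\delta+b+1)-(1-x-y)(\beta+n_2+1)\right)u-y(1-x-y)u_y+yz\,u_z$, $\mathcal{N}_{0,4}^{+}u=-\frac{n_2}{1-x}u+\frac{n_3y}{(1-x)(1-x-y)}u+\frac{y}{1-x}u_y-\frac{yz}{(1-x)(1-x-y)}u_z$, $\mathcal{N}_{0,5}u=\left(y(n_2+n_3+\gamma+\delta+b+2)-(1-x-y)\beta\right)u-y(1-x-y)u_y+yz\,u_z$, $\mathcal{N}_{0,5}^{+}u=\frac{n_2+n_3}{1-x}u+\left(1-\frac{y}{1-x}\right)u_y-\frac{z}{1-x}u_z$, $\mathcal{N}_{0,6}u=\beta u+\frac{n_3y}{1-x-y}u+y\,u_y-\frac{yz}{1-x-y}u_z$, $\mathcal{N}_{0,6}^{+}u=(\gamma+\delta+n_3+b+1)u-(1-x-y)u_y+z\,u_z$;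 $\mathcal{N}_{1,0}u=\frac{n_2+n_3}{1-x}u+u_x-\frac{y}{1-x}u_y-\frac{z}{1-x}u_z$, $\mathcal{N}_{1,0}^{+}u=\left(x(n_2+n_3+e+2)-\alpha\right)u-x(1-x)u_x+xy\,u_y+xz\,u_z$, $\mathcal{N}_{2,0}u=(n+n_2+n_3+e+3)u+\frac{(n_2+n_3)x}{1-x}u+x\,u_x-\frac{xy}{1-x}u_y-\frac{xz}{1-x}u_z$, $\mathcal{N}_{2,0}^{+}u=(n+n_2+n_3+e-\alpha+2-nx)u-x(1-x)u_x+xy\,u_y+xz\,u_z$, $\mathcal{N}_{3,0}u=(n+e+3)u-(1-x)u_x+y\,u_y+z\,u_z$, $\mathcal{N}_{3,0}^{+}u=(\alpha+nx)u+x(1-x)u_x-xy\,u_y-xz\,u_z$, $\mathcal{N}_{4,0}u=\left(x(n+e+3)-\alpha-n_1-1\right)u-x(1-x)u_x+xy\,u_y+xz\,u_z$, $\mathcal{N}_{4,0}^{+}u=-nu+\frac{n_2+n_3}{1-x}u+x\,u_x-\frac{xy}{1-x}u_y-\frac{xz}{1-x}u_z$, $\mathcal{N}_{5,0}u=\left((n+e+3)x-\alpha\right)u-x(1-x)u_x+xy\,u_y+xz\,u_z$, $\mathcal{N}_{5,0}^{+}u=nu+(1-x)u_x-y\,u_y-z\,u_z$, $\mathcal{N}_{6,0}u=\alpha u+\frac{(n_2+n_3)x}{1-x}u+x\,u_x-\frac{xy}{1-x}u_y-\frac{xz}{1-x}u_z$, $\mathcal{N}_{6,0}^{+}u=(n_2+n_3+e-\alpha+2)u-(1-x)u_x+y\,u_y+z\,u_z$;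 $\mathcal{O}_{1,0}u=u_z$, $\mathcal{O}_{1,0}^{+}u=(z\delta-w\gamma)u-zw\,u_z$, $\mathcal{O}_{2,0}u=(\delta+\gamma+n_3+1)u+z\,u_z$, $\mathcal{O}_{2,0}^{+}u=\left(\delta+\frac{n_3w}{1-x-y}\right)u-\frac{zw}{1-x-y}u_z$, $\mathcal{O}_{3,0}u=(\delta+\gamma+n_3+1)u-w\,u_z$, $\mathcal{O}_{3,0}^{+}u=\left(\gamma+\frac{n_3z}{1-x-y}\right)u+\frac{zw}{1-x-y}u_z$, $\mathcal{O}_{4,0}u=\left(z\delta-w(\gamma+n_3+1)\right)u-zw\,u_z$, $\mathcal{O}_{4,0}^{+}u=-\frac{n_3}{1-x-y}u+\frac{z}{1-x-y}u_z$, $\mathcal{O}_{5,0}u=\left((\delta+n_3+1)z-w\gamma\right)u-zw\,u_z$, $\mathcal{O}_{5,0}^{+}u=\frac{n_3}{1-x-y}u+\frac{w}{1-x-y}u_z$, $\mathcal{O}_{6,0}u=\gamma u+z\,u_z$, $\mathcal{O}_{6,0}^{+}u=\delta u-w\,u_z$. *)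

theory Defs
  imports "HOL-Analysis.Analysis"
begin

definition simplex3 :: "(real \<times> real \<times> real) set" where
  "simplex3 = {(x, y, z). x > 0 \<and> y > 0 \<and> z > 0 \<and> 1 - x - y - z > 0}"

text \<open>
  Jacobi polynomials through Rodrigues' formula, for arbitrary real parameters. The real
  powers are meaningful only for \<open>-1 < t < 1\<close>; on \<^term>\<open>simplex3\<close> all arguments occurring
  below lie in that interval.
\<close>
definition jacobi :: "nat \<Rightarrow> real \<Rightarrow> real \<Rightarrow> real \<Rightarrow> real" where
  "jacobi n p q t =
     (-1) ^ n / (2 ^ n * fact n) * (1 - t) powr (- p) * (1 + t) powr (- q) *
     (deriv ^^ n) (\<lambda>s. (1 - s) powr (real n + p) * (1 + s) powr (real n + q)) t"

text \<open>
  The indices are integers so that the convention for negative indices can be expressed.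
\<close>
definition P6 ::
  "int \<Rightarrow> int \<Rightarrow> int \<Rightarrow> real \<Rightarrow> real \<Rightarrow> real \<Rightarrow> real \<Rightarrow> real \<Rightarrow> real \<Rightarrow> real \<Rightarrow> real \<Rightarrow> real \<Rightarrow> real" where
  "P6 n1 n2 n3 \<alpha> \<beta> \<gamma> \<delta> a b x y z =
     (if n1 < 0 \<or> n2 < 0 \<or> n3 < 0 then 0
      else
        jacobi (nat n1)
          (\<beta> + \<gamma> + \<delta> + a + b + 2 * of_int n2 + 2 * of_int n3 + 2) \<alpha> (2 * x - 1) *
        (1 - x) ^ nat n2 *
        jacobi (nat n2) (\<gamma> + \<delta> + 2 * of_int n3 + b + 1) \<beta> (2 * y / (1 - x) - 1) *
        (1 - x - y) ^ nat n3 *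
        jacobi (nat n3) \<delta> \<gamma> (2 * z / (1 - x - y) - 1))"

definition pdx :: "(real \<Rightarrow> real \<Rightarrow> real \<Rightarrow> real) \<Rightarrow> real \<Rightarrow> real \<Rightarrow> real \<Rightarrow> real" where
  "pdx u x y z = deriv (\<lambda>s. u s y z) x"

definition pdy :: "(real \<Rightarrow> real \<Rightarrow> real \<Rightarrow> real) \<Rightarrow> real \<Rightarrow> real \<Rightarrow> real \<Rightarrow> real" where
  "pdy u x y z = deriv (\<lambda>s. u x s z) y"

definition pdz :: "(real \<Rightarrow> real \<Rightarrow> real \<Rightarrow> real) \<Rightarrow> real \<Rightarrow> real \<Rightarrow> real \<Rightarrow> real" where
  "pdz u x y z = deriv (\<lambda>s. u x y s) z"

text \<open>
  All operators take the same list \<open>n1 n2 n3 \<alpha> \<beta> \<gamma> \<delta> a b\<close> of indices and parameters,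
  even where the formula does not use some of them. A name ending in \<open>_plus\<close> stands for the
  operator with superscript \<open>+\<close>; the two digits are the subscripts.
\<close>
type_synonym operator3 =
  "nat \<Rightarrow> nat \<Rightarrow> nat \<Rightarrow> real \<Rightarrow> real \<Rightarrow> real \<Rightarrow> real \<Rightarrow> real \<Rightarrow> real \<Rightarrow>
   (real \<Rightarrow> real \<Rightarrow> real \<Rightarrow> real) \<Rightarrow> real \<Rightarrow> real \<Rightarrow> real \<Rightarrow> real"

definition N01 :: operator3 where
  "N01 n1 n2 n3 \<alpha> \<beta> \<gamma> \<delta> a b u x y z =
     real n3 / (1 - x - y) * u x y z + pdy u x y z - z / (1 - x - y) * pdz u x y z"

definition N01_plus :: operator3 where
  "N01_plus n1 n2 n3 \<alpha> \<beta> \<gamma> \<delta> a b u x y z =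
     (y * (\<gamma> + \<delta> + real n3 + b + 1) - (1 - x - y) * \<beta>) * u x y z
     - y * (1 - x - y) * pdy u x y z + y * z * pdz u x y z"

definition N02 :: operator3 where
  "N02 n1 n2 n3 \<alpha> \<beta> \<gamma> \<delta> a b u x y z =
     (real n2 + 2 * real n3 + \<beta> + \<gamma> + \<delta> + b + 2) * u x y z
     + real n3 * y / (1 - x - y) * u x y z + y * pdy u x y z
     - y * z / (1 - x - y) * pdz u x y z"

definition N02_plus :: operator3 where
  "N02_plus n1 n2 n3 \<alpha> \<beta> \<gamma> \<delta> a b u x y z =
     (real n2 + 2 * real n3 + \<gamma> + \<delta> + b + 1) * u x y z
     - (real n2 + real n3) * y / (1 - x) * u x y z
     - y * (1 - x - y) / (1 - x) * pdy u x y z + y * z / (1 - x) * pdz u x y z"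

definition N03 :: operator3 where
  "N03 n1 n2 n3 \<alpha> \<beta> \<gamma> \<delta> a b u x y z =
     (real n2 + real n3 + \<beta> + \<gamma> + \<delta> + b + 2) * u x y z - (1 - x - y) * pdy u x y z
     + z * pdz u x y z"

definition N03_plus :: operator3 where
  "N03_plus n1 n2 n3 \<alpha> \<beta> \<gamma> \<delta> a b u x y z =
     (\<beta> + (real n2 + real n3) / (1 - x) * y) * u x y z
     + y * (1 - x - y) / (1 - x) * pdy u x y z - y * z / (1 - x) * pdz u x y z"

definition N04 :: operator3 where
  "N04 n1 n2 n3 \<alpha> \<beta> \<gamma> \<delta> a b u x y z =
     (y * (real n3 + \<gamma> + \<delta> + b + 1) - (1 - x - y) * (\<beta> + real n2 + 1)) * u x y z
     - y * (1 - x - y) * pdy u x y z + y * z * pdz u x y z"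

definition N04_plus :: operator3 where
  "N04_plus n1 n2 n3 \<alpha> \<beta> \<gamma> \<delta> a b u x y z =
     - (real n2 / (1 - x)) * u x y z
     + real n3 * y / ((1 - x) * (1 - x - y)) * u x y z + y / (1 - x) * pdy u x y z
     - y * z / ((1 - x) * (1 - x - y)) * pdz u x y z"

definition N05 :: operator3 where
  "N05 n1 n2 n3 \<alpha> \<beta> \<gamma> \<delta> a b u x y z =
     (y * (real n2 + real n3 + \<gamma> + \<delta> + b + 2) - (1 - x - y) * \<beta>) * u x y z
     - y * (1 - x - y) * pdy u x y z + y * z * pdz u x y z"

definition N05_plus :: operator3 where
  "N05_plus n1 n2 n3 \<alpha> \<beta> \<gamma> \<delta> a b u x y z =
     (real n2 + real n3) / (1 - x) * u x y z + (1 - y / (1 - x)) * pdy u x y z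
     - z / (1 - x) * pdz u x y z"

definition N06 :: operator3 where
  "N06 n1 n2 n3 \<alpha> \<beta> \<gamma> \<delta> a b u x y z =
     \<beta> * u x y z + real n3 * y / (1 - x - y) * u x y z + y * pdy u x y z
     - y * z / (1 - x - y) * pdz u x y z"

definition N06_plus :: operator3 where
  "N06_plus n1 n2 n3 \<alpha> \<beta> \<gamma> \<delta> a b u x y z =
     (\<gamma> + \<delta> + real n3 + b + 1) * u x y z - (1 - x - y) * pdy u x y z
     + z * pdz u x y z"

definition N10 :: operator3 where
  "N10 n1 n2 n3 \<alpha> \<beta> \<gamma> \<delta> a b u x y z =
     (real n2 + real n3) / (1 - x) * u x y z + pdx u x y z
     - y / (1 - x) * pdy u x y z - z / (1 - x) * pdz u x y z"

definition N10_plus :: operator3 where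
  "N10_plus n1 n2 n3 \<alpha> \<beta> \<gamma> \<delta> a b u x y z =
     (let e = \<alpha> + \<beta> + \<gamma> + \<delta> + a + b
      in (x * (real n2 + real n3 + e + 2) - \<alpha>) * u x y z - x * (1 - x) * pdx u x y z
         + x * y * pdy u x y z + x * z * pdz u x y z)"

definition N20 :: operator3 where
  "N20 n1 n2 n3 \<alpha> \<beta> \<gamma> \<delta> a b u x y z =
     (let n = real (n1 + n2 + n3); e = \<alpha> + \<beta> + \<gamma> + \<delta> + a + b
      in (n + real n2 + real n3 + e + 3) * u x y z
         + (real n2 + real n3) * x / (1 - x) * u x y z + x * pdx u x y z
         - x * y / (1 - x) * pdy u x y z - x * z / (1 - x) * pdz u x y z)"

definition N20_plus :: operator3 where
  "N20_plus n1 n2 n3 \<alpha> \<beta> \<gamma> \<delta> a b u x y z =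
     (let n = real (n1 + n2 + n3); e = \<alpha> + \<beta> + \<gamma> + \<delta> + a + b
      in (n + real n2 + real n3 + e - \<alpha> + 2 - n * x) * u x y z
         - x * (1 - x) * pdx u x y z + x * y * pdy u x y z + x * z * pdz u x y z)"

definition N30 :: operator3 where
  "N30 n1 n2 n3 \<alpha> \<beta> \<gamma> \<delta> a b u x y z =
     (let n = real (n1 + n2 + n3); e = \<alpha> + \<beta> + \<gamma> + \<delta> + a + b
      in (n + e + 3) * u x y z - (1 - x) * pdx u x y z + y * pdy u x y z
         + z * pdz u x y z)"

definition N30_plus :: operator3 where
  "N30_plus n1 n2 n3 \<alpha> \<beta> \<gamma> \<delta> a b u x y z =
     (let n = real (n1 + n2 + n3)
      in (\<alpha> + n * x) * u x y z + x * (1 - x) * pdx u x y z - x * y * pdy u x y z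
         - x * z * pdz u x y z)"

definition N40 :: operator3 where
  "N40 n1 n2 n3 \<alpha> \<beta> \<gamma> \<delta> a b u x y z =
     (let n = real (n1 + n2 + n3); e = \<alpha> + \<beta> + \<gamma> + \<delta> + a + b
      in (x * (n + e + 3) - \<alpha> - real n1 - 1) * u x y z - x * (1 - x) * pdx u x y z
         + x * y * pdy u x y z + x * z * pdz u x y z)"

definition N40_plus :: operator3 where
  "N40_plus n1 n2 n3 \<alpha> \<beta> \<gamma> \<delta> a b u x y z =
     (let n = real (n1 + n2 + n3)
      in - n * u x y z + (real n2 + real n3) / (1 - x) * u x y z + x * pdx u x y z
         - x * y / (1 - x) * pdy u x y z - x * z / (1 - x) * pdz u x y z)"

definition N50 :: operator3 where
  "N50 n1 n2 n3 \<alpha> \<beta> \<gamma> \<delta> a b u x y z =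
     (let n = real (n1 + n2 + n3); e = \<alpha> + \<beta> + \<gamma> + \<delta> + a + b
      in ((n + e + 3) * x - \<alpha>) * u x y z - x * (1 - x) * pdx u x y z
         + x * y * pdy u x y z + x * z * pdz u x y z)"

definition N50_plus :: operator3 where
  "N50_plus n1 n2 n3 \<alpha> \<beta> \<gamma> \<delta> a b u x y z =
     (let n = real (n1 + n2 + n3)
      in n * u x y z + (1 - x) * pdx u x y z - y * pdy u x y z - z * pdz u x y z)"

definition N60 :: operator3 where
  "N60 n1 n2 n3 \<alpha> \<beta> \<gamma> \<delta> a b u x y z =
     \<alpha> * u x y z + (real n2 + real n3) * x / (1 - x) * u x y z + x * pdx u x y z
     - x * y / (1 - x) * pdy u x y z - x * z / (1 - x) * pdz u x y z"

definition N60_plus :: operator3 where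
  "N60_plus n1 n2 n3 \<alpha> \<beta> \<gamma> \<delta> a b u x y z =
     (let e = \<alpha> + \<beta> + \<gamma> + \<delta> + a + b
      in (real n2 + real n3 + e - \<alpha> + 2) * u x y z - (1 - x) * pdx u x y z
         + y * pdy u x y z + z * pdz u x y z)"

definition O10 :: operator3 where
  "O10 n1 n2 n3 \<alpha> \<beta> \<gamma> \<delta> a b u x y z =
     pdz u x y z"

definition O10_plus :: operator3 where
  "O10_plus n1 n2 n3 \<alpha> \<beta> \<gamma> \<delta> a b u x y z =
     (let w = 1 - x - y - z
      in (z * \<delta> - w * \<gamma>) * u x y z - z * w * pdz u x y z)"

definition O20 :: operator3 where
  "O20 n1 n2 n3 \<alpha> \<beta> \<gamma> \<delta> a b u x y z =
     (\<delta> + \<gamma> + real n3 + 1) * u x y z + z * pdz u x y z"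

definition O20_plus :: operator3 where
  "O20_plus n1 n2 n3 \<alpha> \<beta> \<gamma> \<delta> a b u x y z =
     (let w = 1 - x - y - z
      in (\<delta> + real n3 * w / (1 - x - y)) * u x y z
         - z * w / (1 - x - y) * pdz u x y z)"

definition O30 :: operator3 where
  "O30 n1 n2 n3 \<alpha> \<beta> \<gamma> \<delta> a b u x y z =
     (let w = 1 - x - y - z
      in (\<delta> + \<gamma> + real n3 + 1) * u x y z - w * pdz u x y z)"

definition O30_plus :: operator3 where
  "O30_plus n1 n2 n3 \<alpha> \<beta> \<gamma> \<delta> a b u x y z =
     (let w = 1 - x - y - z
      in (\<gamma> + real n3 * z / (1 - x - y)) * u x y z
         + z * w / (1 - x - y) * pdz u x y z)"

definition O40 :: operator3 where
  "O40 n1 n2 n3 \<alpha> \<beta> \<gamma> \<delta> a b u x y z =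
     (let w = 1 - x - y - z
      in (z * \<delta> - w * (\<gamma> + real n3 + 1)) * u x y z - z * w * pdz u x y z)"

definition O40_plus :: operator3 where
  "O40_plus n1 n2 n3 \<alpha> \<beta> \<gamma> \<delta> a b u x y z =
     - (real n3 / (1 - x - y)) * u x y z + z / (1 - x - y) * pdz u x y z"

definition O50 :: operator3 where
  "O50 n1 n2 n3 \<alpha> \<beta> \<gamma> \<delta> a b u x y z =
     (let w = 1 - x - y - z
      in ((\<delta> + real n3 + 1) * z - w * \<gamma>) * u x y z - z * w * pdz u x y z)"

definition O50_plus :: operator3 where
  "O50_plus n1 n2 n3 \<alpha> \<beta> \<gamma> \<delta> a b u x y z =
     (let w = 1 - x - y - z
      in real n3 / (1 - x - y) * u x y z + w / (1 - x - y) * pdz u x y z)"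

definition O60 :: operator3 where
  "O60 n1 n2 n3 \<alpha> \<beta> \<gamma> \<delta> a b u x y z =
     \<gamma> * u x y z + z * pdz u x y z"

definition O60_plus :: operator3 where
  "O60_plus n1 n2 n3 \<alpha> \<beta> \<gamma> \<delta> a b u x y z =
     (let w = 1 - x - y - z
      in \<delta> * u x y z - w * pdz u x y z)"

end

theory Submission
  imports Defs "HOL-Computational_Algebra.Formal_Power_Series"
begin

text \<open>
  Write \<open>s = y / (1 - x)\<close> and \<open>t = z / (1 - x - y)\<close>. On the simplex the six-parameter polynomial
  separates as
  \<open>F x * (1 - x) ^ (n2 + n3) * G s * (1 - s) ^ n3 * H t\<close>, where \<open>F\<close>, \<open>G\<close> and \<open>H\<close> are Jacobi
  polynomials transplanted to \<open>(0, 1)\<close>. The first-order operator \<open>N01\<close> is the vector field along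
  which only \<open>s\<close> varies, corrected by the zeroth-order term that cancels the derivative of
  \<open>(1 - x - y) ^ n3\<close>; hence it replaces \<open>G\<close> by a multiple of \<open>G'\<close> and leaves the other factors
  alone. In the same way \<open>N10\<close> acts on \<open>F\<close> and \<open>O10\<close> on \<open>H\<close> (lemma \<open>P6_base_operators\<close>). Every
  other operator of a family is a multiple of the identity plus a multiple of the base operator of
  that family, the multipliers being functions (lemmas \<open>N0i_via_N01\<close> and \<open>Ni0_via_N10\<close>, and the
  definitions for the third family). So each family reduces to the same twelve
  relations for Jacobi polynomials in one variable; all remaining parameters of the factors are
  chosen in such a way that a step in one factor leaves the other two unchanged.

  The twelve relations come from a generating function. For \<open>0 < s < 1\<close>, the Jacobi polynomial with
  argument \<open>2 s - 1\<close> is the coefficient of \<open>X ^ m\<close> in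
  \<open>(1 + s X) powr (m + p) * (1 + (s - 1) X) powr (m + q)\<close>.
  Splitting off one linear factor gives a Pascal rule in each parameter, differentiating in
  \<open>X\<close> gives an Euler identity, and differentiating in \<open>s\<close> gives the derivative. The twelve relations
  are linear combinations of these facts. That the generating function agrees with Rodrigues'
  formula follows by induction on the order of the derivative: differentiating the weight times the
  polynomial once is one of the twelve relations, \<open>jacobi01_incr_degree_decr_p_decr_q\<close>.
\<close>

section \<open>Binomial series and the generating function\<close>

unbundle no vec_syntax
unbundle fps_syntax

definition binomial_fps :: "real \<Rightarrow> real \<Rightarrow> real fps" where
  "binomial_fps r c = Abs_fps (\<lambda>k. (r gchoose k) * c ^ k)"

lemma binomial_fps_step:
  "binomial_fps (r + 1) c = (1 + fps_const c * fps_X) * binomial_fps r c"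
proof (rule fps_ext)
  fix k
  show "binomial_fps (r + 1) c $ k = ((1 + fps_const c * fps_X) * binomial_fps r c) $ k"
  proof (cases k)
    case (Suc j)
    have "binomial_fps (r + 1) c $ k = ((r gchoose j) + (r gchoose Suc j)) * c ^ Suc j"
      by (simp add: Suc binomial_fps_def gbinomial_Suc_Suc)
    also have "\<dots> = (r gchoose Suc j) * c ^ Suc j + c * ((r gchoose j) * c ^ j)"
      by (simp add: distrib_right)
    also have "\<dots> = ((1 + fps_const c * fps_X) * binomial_fps r c) $ k"
      by (simp add: Suc binomial_fps_def distrib_right mult.assoc)
    finally show ?thesis .
  qed (simp add: binomial_fps_def distrib_right mult.assoc)
qed

lemma fps_deriv_binomial_fps:
  "fps_deriv (binomial_fps r c) = fps_const (r * c) * binomial_fps (r - 1) c"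
proof (rule fps_ext)
  fix k
  show "fps_deriv (binomial_fps r c) $ k = (fps_const (r * c) * binomial_fps (r - 1) c) $ k"
    using gbinomial_absorption[of k r]
    by (simp add: binomial_fps_def)
qed

text \<open>
  With separate arguments \<open>c\<close> and \<open>d\<close> the coefficient is a form of degree \<open>m\<close> in \<open>(c, d)\<close>, which
  exposes the symmetry \<open>(p, c) \<leftrightarrow> (q, d)\<close>; the Jacobi polynomial is its restriction to the line
  \<open>c - d = 1\<close>. The degree is an integer so that the lowering relations hold in degree \<open>0\<close> as well.
\<close>
definition jacobi_coeff :: "int \<Rightarrow> real \<Rightarrow> real \<Rightarrow> real \<Rightarrow> real \<Rightarrow> real" where
  "jacobi_coeff m p q c d =
     (if m < 0 then 0
      else (binomial_fps (of_int m + p) c * binomial_fps (of_int m + q) d) $ nat m)"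

lemma jacobi_coeff_0 [simp]: "jacobi_coeff 0 p q c d = 1"
  by (simp add: jacobi_coeff_def binomial_fps_def)

lemma jacobi_coeff_neg [simp]: "m < 0 \<Longrightarrow> jacobi_coeff m p q c d = 0"
  by (simp add: jacobi_coeff_def)

lemma jacobi_coeff_commute: "jacobi_coeff m p q c d = jacobi_coeff m q p d c"
  by (simp add: jacobi_coeff_def mult.commute)

text \<open>
  Passing from \<open>(m - 1, p + 1, q + 1)\<close> to \<open>(m, p, q)\<close> leaves both exponents \<open>m + p\<close> and \<open>m + q\<close>
  of the series unchanged, so the two terms on the right are neighbouring coefficients of a
  single series, and raising \<open>p\<close> multiplies that series by \<open>1 + c X\<close>.
\<close>
lemma jacobi_coeff_Pascal:
  "jacobi_coeff m (p + 1) q c d =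
     jacobi_coeff m p q c d + c * jacobi_coeff (m - 1) (p + 1) (q + 1) c d"
proof (cases "m > 0")
  case True
  then obtain k where m: "m = int (Suc k)"
    by (metis gr0_conv_Suc zero_less_imp_eq_int)
  define F where "F = binomial_fps (of_int m + p) c * binomial_fps (of_int m + q) d"
  have "binomial_fps (of_int m + (p + 1)) c * binomial_fps (of_int m + q) d = F + fps_const c * (fps_X * F)"
    using binomial_fps_step[of "of_int m + p" c]    by (simp add: F_def algebra_simps)
  then have "(binomial_fps (of_int m + (p + 1)) c * binomial_fps (of_int m + q) d) $ Suc k = F $ Suc k + c * F $ k"
    by simp
  moreover have "jacobi_coeff (m - 1) (p + 1) (q + 1) c d = F $ k"
    by (simp add: jacobi_coeff_def F_def m algebra_simps)
  moreover have "jacobi_coeff m p q c d = F $ Suc k"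
    by (simp add: jacobi_coeff_def F_def m del: of_nat_Suc)
  moreover have "jacobi_coeff m (p + 1) q c d =
      (binomial_fps (of_int m + (p + 1)) c * binomial_fps (of_int m + q) d) $ Suc k"
    by (simp add: jacobi_coeff_def m del: of_nat_Suc)
  ultimately show ?thesis
    by simp
qed (cases "m = 0"; simp)

text \<open>
  The coefficient of \<open>X ^ (m - 1)\<close> in the derivative of the generating function with respect to
  \<open>X\<close>. It is Euler's identity for forms of degree \<open>m\<close>, since the two coefficients
  on the right belong to the partial derivatives in \<open>c\<close> and \<open>d\<close>.
\<close>
lemma jacobi_coeff_Euler:
  "of_int m * jacobi_coeff m p q c d =
     (of_int m + p) * c * jacobi_coeff (m - 1) p (q + 1) c d +
     (of_int m + q) * d * jacobi_coeff (m - 1) (p + 1) q c d"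
proof (cases "m > 0")
  case True
  then obtain k where m: "m = int (Suc k)"
    by (metis gr0_conv_Suc zero_less_imp_eq_int)
  define r s where "r = of_int m + p" and "s = of_int m + q"
  have "of_int m * jacobi_coeff m p q c d = fps_deriv (binomial_fps r c * binomial_fps s d) $ k"
    unfolding fps_deriv_nth by (simp add: jacobi_coeff_def m r_def s_def del: of_nat_Suc)
  also have "\<dots> = (fps_const (r * c) * (binomial_fps (r - 1) c * binomial_fps s d) +
                   fps_const (s * d) * (binomial_fps r c * binomial_fps (s - 1) d)) $ k"
    by (simp add: fps_deriv_binomial_fps mult_ac add.commute)
  also have "\<dots> = r * c * (binomial_fps (r - 1) c * binomial_fps s d) $ k +
                  s * d * (binomial_fps r c * binomial_fps (s - 1) d) $ k"
    by (simp only: fps_add_nth fps_mult_left_const_nth)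
  also have "\<dots> = r * c * jacobi_coeff (m - 1) p (q + 1) c d + s * d * jacobi_coeff (m - 1) (p + 1) q c d"
    by (simp add: jacobi_coeff_def m r_def s_def algebra_simps)
  finally show ?thesis by (simp add: r_def s_def)
qed (cases "m = 0"; simp)

text \<open>
  Differentiating \<open>(1 + c X) powr r\<close> with respect to \<open>c\<close> gives \<open>r X (1 + c X) powr (r - 1)\<close>; the factor
  \<open>X\<close> lowers the degree by one.
\<close>
lemma DERIV_jacobi_coeff:
  fixes f g :: "real \<Rightarrow> real"
  assumes f: "(f has_real_derivative f') (at s)" and g: "(g has_real_derivative g') (at s)"
  shows "((\<lambda>s. jacobi_coeff m p q (f s) (g s)) has_real_derivative
           (of_int m + p) * jacobi_coeff (m - 1) p (q + 1) (f s) (g s) * f' +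
           (of_int m + q) * jacobi_coeff (m - 1) (p + 1) q (f s) (g s) * g') (at s)"
proof (cases "m > 0")
  case True
  then obtain k where m: "m = int (Suc k)"
    by (metis gr0_conv_Suc zero_less_imp_eq_int)
  define a b where "a = of_int m + p" and "b = of_int m + q"
  have dB: "((\<lambda>s. binomial_fps r (h s) $ i) has_real_derivative
              ((fps_const r * (fps_X * binomial_fps (r - 1) (h s))) $ i) * h') (at s)"
    if "(h has_real_derivative h') (at s)" for r i h h'
  proof (cases i)
    case (Suc j)
    have "((\<lambda>s. (r gchoose i) * h s ^ i) has_real_derivative
        (r gchoose i) * (real i * (h' * h s ^ (i - Suc 0)))) (at s)"
      using that by (intro DERIV_cmult DERIV_power)
    also have "(r gchoose i) * (real i * (h' * h s ^ (i - Suc 0))) =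
        (real (Suc j) * (r gchoose Suc j)) * (h' * h s ^ j)"
      by (simp add: Suc mult_ac)
    also note gbinomial_absorption[of j r]
    finally show ?thesis
      by (simp add: Suc binomial_fps_def mult_ac)
  qed (simp add: binomial_fps_def)
  have "((\<lambda>s. (binomial_fps a (f s) * binomial_fps b (g s)) $ Suc k) has_real_derivative
          (fps_const a * (fps_X * binomial_fps (a - 1) (f s)) * binomial_fps b (g s)) $ Suc k * f' +
          (binomial_fps a (f s) * (fps_const b * (fps_X * binomial_fps (b - 1) (g s)))) $ Suc k * g')
        (at s)"
    unfolding fps_mult_nth[of "binomial_fps a (f _)"]
      fps_mult_nth[of "fps_const a * (fps_X * binomial_fps (a - 1) (f s))"]
    by (rule derivative_eq_intros dB f g refl)+
       (simp only: sum.distrib sum_distrib_left sum_distrib_right mult_ac add.commute)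
  also have "(fps_const a * (fps_X * binomial_fps (a - 1) (f s)) * binomial_fps b (g s)) $ Suc k =
      a * (binomial_fps (a - 1) (f s) * binomial_fps b (g s)) $ k"
    by (simp add: mult.assoc)
  also have "binomial_fps a (f s) * (fps_const b * (fps_X * binomial_fps (b - 1) (g s))) =
      fps_const b * (fps_X * (binomial_fps a (f s) * binomial_fps (b - 1) (g s)))"
    by (simp add: mult_ac)
  also have "\<dots> $ Suc k = b * (binomial_fps a (f s) * binomial_fps (b - 1) (g s)) $ k"
    by simp
  finally have "((\<lambda>s. jacobi_coeff m p q (f s) (g s)) has_real_derivative
      a * (binomial_fps (a - 1) (f s) * binomial_fps b (g s)) $ k * f' +
      b * (binomial_fps a (f s) * binomial_fps (b - 1) (g s)) $ k * g') (at s)"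
    by (simp add: jacobi_coeff_def m a_def b_def del: of_nat_Suc)
  moreover have "jacobi_coeff (m - 1) p (q + 1) (f s) (g s) =
      (binomial_fps (a - 1) (f s) * binomial_fps b (g s)) $ k"
    by (simp add: jacobi_coeff_def m a_def b_def algebra_simps)
  moreover have "jacobi_coeff (m - 1) (p + 1) q (f s) (g s) =
      (binomial_fps a (f s) * binomial_fps (b - 1) (g s)) $ k"
    by (simp add: jacobi_coeff_def m a_def b_def algebra_simps)
  ultimately show ?thesis
    by (simp add: a_def b_def)
qed (cases "m = 0"; simp)

section \<open>Ladder relations for Jacobi polynomials on the unit interval\<close>

definition jacobi01 :: "int \<Rightarrow> real \<Rightarrow> real \<Rightarrow> real \<Rightarrow> real" where
  "jacobi01 m p q s = jacobi_coeff m p q s (s - 1)"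

text \<open>
  The derivative of \<open>jacobi01\<close>; this expression for it is the ladder relation that lowers the
  degree and raises both parameters.
\<close>
definition jacobi01' :: "int \<Rightarrow> real \<Rightarrow> real \<Rightarrow> real \<Rightarrow> real" where
  "jacobi01' m p q s = (of_int m + p + q + 1) * jacobi01 (m - 1) (p + 1) (q + 1) s"

lemma jacobi01_Pascal_left:
  "jacobi01 m (p + 1) q s = jacobi01 m p q s + s * jacobi01 (m - 1) (p + 1) (q + 1) s"
  unfolding jacobi01_def by (rule jacobi_coeff_Pascal)

lemma jacobi01_Pascal_right:
  "jacobi01 m p (q + 1) s = jacobi01 m p q s + (s - 1) * jacobi01 (m - 1) (p + 1) (q + 1) s"
  unfolding jacobi01_def by (subst (1 2 3) jacobi_coeff_commute) (rule jacobi_coeff_Pascal)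

lemma jacobi01_Euler:
  "of_int m * jacobi01 m p q s =
     (of_int m + p) * s * jacobi01 (m - 1) p (q + 1) s +
     (of_int m + q) * (s - 1) * jacobi01 (m - 1) (p + 1) q s"
  unfolding jacobi01_def by (rule jacobi_coeff_Euler)

text \<open>
  The right-hand side is what the chain rule yields along \<open>c = s\<close>, \<open>d = s - 1\<close>. Moving both terms
  to the parameters \<open>(p + 1, q + 1)\<close> with the Pascal rules produces an error that is exactly the
  right-hand side of Euler's identity in degree \<open>m - 1\<close>.
\<close>
lemma jacobi01'_eq:
  "jacobi01' m p q s =
     (of_int m + p) * jacobi01 (m - 1) p (q + 1) s + (of_int m + q) * jacobi01 (m - 1) (p + 1) q s"
proof -
  define X Y Z where "X = jacobi01 (m - 1) (p + 1) (q + 1) s"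
    and "Y = jacobi01 (m - 1 - 1) (p + 1) (q + 1 + 1) s" and "Z = jacobi01 (m - 1 - 1) (p + 1 + 1) (q + 1) s"
  have "jacobi01 (m - 1) p (q + 1) s = X - s * Y"
    using jacobi01_Pascal_left[of "m - 1" p "q + 1" s] by (simp add: X_def Y_def)
  moreover have "jacobi01 (m - 1) (p + 1) q s = X - (s - 1) * Z"
    using jacobi01_Pascal_right[of "m - 1" "p + 1" q s] by (simp add: X_def Z_def)
  moreover have "(of_int m - 1) * X = (of_int m + p) * (s * Y) + (of_int m + q) * ((s - 1) * Z)"
    using jacobi01_Euler[of "m - 1" "p + 1" "q + 1" s] unfolding X_def Y_def Z_def by (simp add: mult.assoc)
  moreover from this have "(of_int m + p + q + 1) * X =
      (of_int m + p) * (X - s * Y) + (of_int m + q) * (X - (s - 1) * Z)"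
    by algebra
  ultimately show ?thesis
    unfolding jacobi01'_def X_def [symmetric] by simp
qed

lemma DERIV_jacobi01: "(jacobi01 m p q has_real_derivative jacobi01' m p q s) (at s)"
proof -
  have "((\<lambda>s. s) has_real_derivative 1) (at s)" "((\<lambda>s. s - 1) has_real_derivative 1) (at s)"
    by (auto intro!: derivative_eq_intros)
  from DERIV_jacobi_coeff[OF this, of m p q] show ?thesis
    by (simp add: jacobi01'_eq jacobi01_def[abs_def])
qed

text \<open>
  By Euler's identity, the combinations in the following two relations isolate the partial
  derivatives in \<open>d\<close> and in \<open>c\<close>. The relations of fixed degree combine these two, or the
  definition of \<open>jacobi01'\<close>, with the Pascal rules.
\<close>
lemma jacobi01_decr_degree_incr_p:
  "- of_int m * jacobi01 m p q s + s * jacobi01' m p q s =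
     (of_int m + q) * jacobi01 (m - 1) (p + 1) q s"
  unfolding jacobi01'_eq mult_minus_left jacobi01_Euler[of m p q s] by (simp add: algebra_simps)

lemma jacobi01_decr_degree_incr_q:
  "of_int m * jacobi01 m p q s + (1 - s) * jacobi01' m p q s =
     (of_int m + p) * jacobi01 (m - 1) p (q + 1) s"
  unfolding jacobi01'_eq jacobi01_Euler[of m p q s] by (simp add: algebra_simps)

lemma jacobi01_incr_p:
  "(of_int m + p + q + 1) * jacobi01 m p q s + s * jacobi01' m p q s =
     (of_int m + p + q + 1) * jacobi01 m (p + 1) q s"
  unfolding jacobi01'_def jacobi01_Pascal_left[of m p q s] by (simp add: algebra_simps)

lemma jacobi01_incr_q:
  "(of_int m + p + q + 1) * jacobi01 m p q s - (1 - s) * jacobi01' m p q s =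
     (of_int m + p + q + 1) * jacobi01 m p (q + 1) s"
  unfolding jacobi01'_def jacobi01_Pascal_right[of m p q s] by (simp add: algebra_simps)

lemma jacobi01_decr_p:
  "(p + of_int m * (1 - s)) * jacobi01 m p q s - s * (1 - s) * jacobi01' m p q s =
     (of_int m + p) * jacobi01 m (p - 1) q s"
proof -
  have Pascal: "jacobi01 m p q s = jacobi01 m (p - 1) q s + s * jacobi01 (m - 1) p (q + 1) s"
    using jacobi01_Pascal_left[of m "p - 1" q s] by simp
  have "(p + of_int m * (1 - s)) * jacobi01 m p q s - s * (1 - s) * jacobi01' m p q s =
    (of_int m + p) * jacobi01 m p q s
    - s * (of_int m * jacobi01 m p q s + (1 - s) * jacobi01' m p q s)"
    by (simp add: algebra_simps)
  also have "\<dots> = (of_int m + p) * jacobi01 m (p - 1) q s"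
    unfolding jacobi01_decr_degree_incr_q unfolding Pascal by (simp add: algebra_simps)
  finally show ?thesis .
qed

lemma jacobi01_decr_q:
  "(q + of_int m * s) * jacobi01 m p q s + s * (1 - s) * jacobi01' m p q s =
     (of_int m + q) * jacobi01 m p (q - 1) s"
proof -
  have Pascal: "jacobi01 m p q s = jacobi01 m p (q - 1) s + (s - 1) * jacobi01 (m - 1) (p + 1) q s"
    using jacobi01_Pascal_right[of m p "q - 1" s] by simp
  have "(q + of_int m * s) * jacobi01 m p q s + s * (1 - s) * jacobi01' m p q s =
    (of_int m + q) * jacobi01 m p q s
    + (1 - s) * (- of_int m * jacobi01 m p q s + s * jacobi01' m p q s)"
    by (simp add: algebra_simps)
  also have "\<dots> = (of_int m + q) * jacobi01 m p (q - 1) s"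
    unfolding jacobi01_decr_degree_incr_p unfolding Pascal by (simp add: algebra_simps)
  finally show ?thesis .
qed

lemma jacobi01_incr_p_decr_q:
  "q * jacobi01 m p q s + s * jacobi01' m p q s = (of_int m + q) * jacobi01 m (p + 1) (q - 1) s"
proof -
  have "jacobi01 m (p + 1) (q - 1) s = jacobi01 m p q s + jacobi01 (m - 1) (p + 1) q s"
    using jacobi01_Pascal_left[of m p "q - 1" s] jacobi01_Pascal_right[of m p "q - 1" s]
    by (simp add: algebra_simps)
  moreover have "q * jacobi01 m p q s + s * jacobi01' m p q s =
    (of_int m + q) * jacobi01 m p q s + (- of_int m * jacobi01 m p q s + s * jacobi01' m p q s)"
    by (simp add: algebra_simps)
  ultimately show ?thesis
    unfolding jacobi01_decr_degree_incr_p by (simp add: distrib_left)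
qed

lemma jacobi01_decr_p_incr_q:
  "p * jacobi01 m p q s - (1 - s) * jacobi01' m p q s = (of_int m + p) * jacobi01 m (p - 1) (q + 1) s"
proof -
  have "jacobi01 m (p - 1) (q + 1) s = jacobi01 m p q s - jacobi01 (m - 1) p (q + 1) s"
    using jacobi01_Pascal_left[of m "p - 1" q s] jacobi01_Pascal_right[of m "p - 1" q s]
    by (simp add: algebra_simps)
  moreover have "p * jacobi01 m p q s - (1 - s) * jacobi01' m p q s =
    (of_int m + p) * jacobi01 m p q s - (of_int m * jacobi01 m p q s + (1 - s) * jacobi01' m p q s)"
    by (simp add: algebra_simps)
  ultimately show ?thesis
    unfolding jacobi01_decr_degree_incr_q by (simp add: right_diff_distrib)
qed

text \<open>
  The sum of \<open>s\<close> times the relation lowering \<open>p\<close> and \<open>s - 1\<close> times the relation lowering \<open>q\<close> is the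
  right-hand side of Euler's identity in degree \<open>m + 1\<close>.
\<close>
lemma jacobi01_incr_degree_decr_p_decr_q:
  "(s * p - (1 - s) * q) * jacobi01 m p q s - s * (1 - s) * jacobi01' m p q s =
     (of_int m + 1) * jacobi01 (m + 1) (p - 1) (q - 1) s"
proof -
  have Euler: "(of_int m + 1) * jacobi01 (m + 1) (p - 1) (q - 1) s =
      (of_int m + p) * s * jacobi01 m (p - 1) q s + (of_int m + q) * (s - 1) * jacobi01 m p (q - 1) s"
    using jacobi01_Euler[of "m + 1" "p - 1" "q - 1" s] by simp
  have "(s * p - (1 - s) * q) * jacobi01 m p q s - s * (1 - s) * jacobi01' m p q s =
    s * ((p + of_int m * (1 - s)) * jacobi01 m p q s - s * (1 - s) * jacobi01' m p q s)
    - (1 - s) * ((q + of_int m * s) * jacobi01 m p q s + s * (1 - s) * jacobi01' m p q s)"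
    by (simp add: algebra_simps)
  then show ?thesis
    unfolding jacobi01_decr_p jacobi01_decr_q Euler by (simp add: algebra_simps)
qed

lemma jacobi01_incr_degree_decr_p:
  "(s * p - (1 - s) * (q + of_int m + 1)) * jacobi01 m p q s - s * (1 - s) * jacobi01' m p q s =
     (of_int m + 1) * jacobi01 (m + 1) (p - 1) q s"
proof -
  have Pascal: "jacobi01 (m + 1) (p - 1) q s =
      jacobi01 (m + 1) (p - 1) (q - 1) s + (s - 1) * jacobi01 m p q s"
    using jacobi01_Pascal_right[of "m + 1" "p - 1" "q - 1" s] by simp
  have "(of_int m + 1) * jacobi01 (m + 1) (p - 1) q s =
     ((s * p - (1 - s) * q) * jacobi01 m p q s - s * (1 - s) * jacobi01' m p q s)
     + (of_int m + 1) * ((s - 1) * jacobi01 m p q s)"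
    unfolding jacobi01_incr_degree_decr_p_decr_q Pascal by (rule distrib_left)
  then show ?thesis
    by (simp add: algebra_simps)
qed

lemma jacobi01_incr_degree_decr_q:
  "((p + of_int m + 1) * s - (1 - s) * q) * jacobi01 m p q s - s * (1 - s) * jacobi01' m p q s =
     (of_int m + 1) * jacobi01 (m + 1) p (q - 1) s"
proof -
  have Pascal: "jacobi01 (m + 1) p (q - 1) s =
      jacobi01 (m + 1) (p - 1) (q - 1) s + s * jacobi01 m p q s"
    using jacobi01_Pascal_left[of "m + 1" "p - 1" "q - 1" s] by simp
  have "(of_int m + 1) * jacobi01 (m + 1) p (q - 1) s =
     ((s * p - (1 - s) * q) * jacobi01 m p q s - s * (1 - s) * jacobi01' m p q s)
     + (of_int m + 1) * (s * jacobi01 m p q s)"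
    unfolding jacobi01_incr_degree_decr_p_decr_q Pascal by (rule distrib_left)
  then show ?thesis
    by (simp add: algebra_simps)
qed

text \<open>
  The twelve relations in the order in which the operators of each of the three families are
  listed: entry \<open>2 i - 1\<close> belongs to subscript \<open>i\<close>, entry \<open>2 i\<close> to its \<open>plus\<close> version.
\<close>
lemmas jacobi01_ladder =
  jacobi01'_def
  jacobi01_incr_degree_decr_p_decr_q
  jacobi01_incr_p
  jacobi01_decr_p
  jacobi01_incr_q
  jacobi01_decr_q
  jacobi01_incr_degree_decr_p
  jacobi01_decr_degree_incr_p
  jacobi01_incr_degree_decr_q
  jacobi01_decr_degree_incr_q
  jacobi01_incr_p_decr_q
  jacobi01_decr_p_incr_q

section \<open>Rodrigues' formula\<close>

text \<open>
  Stated with fixed exponents \<open>P\<close> and \<open>Q\<close>, so that the parameters \<open>(P - k, Q - k)\<close> drop by one with each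
  derivative while the degree grows: the step is the relation raising the degree and
  lowering both parameters.
\<close>
lemma Rodrigues_iterate:
  fixes P Q t :: real
  assumes "-1 < t" "t < 1"
  shows "(deriv ^^ k) (\<lambda>s. (1 - s) powr P * (1 + s) powr Q) t =
    (-2) ^ k * fact k * ((1 - t) powr (P - k) * (1 + t) powr (Q - k) *
      jacobi01 (int k) (P - k) (Q - k) ((t + 1) / 2))"
  using assms
proof (induction k arbitrary: t)
  case 0
  then show ?case by (simp add: jacobi01_def)
next
  case (Suc k)
  define p q where "p = P - real k" and "q = Q - real k"
  define s where "s = (t + 1) / 2"
  let ?w = "\<lambda>t. (1 - t) powr p * (1 + t) powr q"
  have "deriv ((deriv ^^ k) (\<lambda>s. (1 - s) powr P * (1 + s) powr Q)) t =
      deriv (\<lambda>t. (-2) ^ k * fact k * (?w t * jacobi01 (int k) p q ((t + 1) / 2))) t"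
  proof (rule deriv_cong_ev)
    have "\<forall>\<^sub>F t in nhds t. t \<in> {-1<..<1}"
      using Suc.prems by (intro eventually_nhds_in_open) auto
    then show "\<forall>\<^sub>F t in nhds t. (deriv ^^ k) (\<lambda>s. (1 - s) powr P * (1 + s) powr Q) t =
        (-2) ^ k * fact k * (?w t * jacobi01 (int k) p q ((t + 1) / 2))"
      by eventually_elim (use Suc.IH in \<open>simp add: p_def q_def\<close>)
  qed simp
  also have "\<dots> = (-2) ^ Suc k * fact (Suc k) * ((1 - t) powr (p - 1) * (1 + t) powr (q - 1) *
      jacobi01 (int k + 1) (p - 1) (q - 1) s)"
  proof (rule DERIV_imp_deriv)
    \<comment> \<open>All terms of the derivative share the weight with both exponents lowered by one; in terms of
      \<open>s = (t + 1) / 2\<close> the missing factors are \<open>1 - t = 2 (1 - s)\<close> and \<open>1 + t = 2 s\<close>.\<close>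
    define W where "W = (1 - t) powr (p - 1) * (1 + t) powr (q - 1)"
    have powr_p: "(1 - t) powr p = (1 - t) * (1 - t) powr (p - 1)"
      using Suc.prems powr_mult_base[of "1 - t" "p - 1"] by simp
    have powr_q: "(1 + t) powr q = (1 + t) * (1 + t) powr (q - 1)"
      using Suc.prems powr_mult_base[of "1 + t" "q - 1"] by simp
    have t: "1 - t = 2 * (1 - s)" "1 + t = 2 * s"
      by (simp_all add: s_def field_simps)
    have w: "?w t = W * (4 * s * (1 - s))"
      unfolding powr_p powr_q W_def by (simp add: t)
    have "((\<lambda>t. (-2) ^ k * fact k * (?w t * jacobi01 (int k) p q ((t + 1) / 2))) has_real_derivative
        (-2) ^ k * fact k * ((- p * ((1 - t) powr (p - 1) * (1 + t) powr q)
          + q * ((1 - t) powr p * (1 + t) powr (q - 1))) * jacobi01 (int k) p q s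
          + ?w t * (jacobi01' (int k) p q s / 2))) (at t)"
    proof -
      have "((\<lambda>t. (1 - t) powr p) has_real_derivative - p * (1 - t) powr (p - 1)) (at t)"
        using Suc.prems by (auto intro!: derivative_eq_intros)
      moreover have "((\<lambda>t. (1 + t) powr q) has_real_derivative q * (1 + t) powr (q - 1)) (at t)"
        using Suc.prems by (auto intro!: derivative_eq_intros)
      moreover have "((\<lambda>t. jacobi01 (int k) p q ((t + 1) / 2)) has_real_derivative
          jacobi01' (int k) p q s / 2) (at t)"
      proof -
        have "((\<lambda>t. (t + 1) / 2) has_real_derivative 1 / 2) (at t)"
          by (auto intro!: derivative_eq_intros)
        from DERIV_chain2[OF DERIV_jacobi01 this] show ?thesis
          by (simp add: s_def)
      qed
      ultimately show ?thesis
        by (intro DERIV_cong[OF DERIV_cmult[OF DERIV_mult[OF DERIV_mult]]])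
           (auto simp: s_def algebra_simps)
    qed
    also have "(1 - t) powr (p - 1) * (1 + t) powr q = W * (2 * s)"
      unfolding powr_q W_def by (simp add: t)
    also have "(1 - t) powr p * (1 + t) powr (q - 1) = W * (2 * (1 - s))"
      unfolding powr_p W_def by (simp add: t)
    also have "(-2) ^ k * fact k * ((- p * (W * (2 * s)) + q * (W * (2 * (1 - s)))) * jacobi01 (int k) p q s
          + ?w t * (jacobi01' (int k) p q s / 2)) =
        (-2) ^ k * fact k * (-2 * W) * ((s * p - (1 - s) * q) * jacobi01 (int k) p q s
          - s * (1 - s) * jacobi01' (int k) p q s)"
      unfolding w by (simp add: algebra_simps)
    also note jacobi01_incr_degree_decr_p_decr_q[of s p q "int k"]
    finally show "((\<lambda>t. (-2) ^ k * fact k * (?w t * jacobi01 (int k) p q ((t + 1) / 2)))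
        has_real_derivative (-2) ^ Suc k * fact (Suc k) *
          ((1 - t) powr (p - 1) * (1 + t) powr (q - 1) * jacobi01 (int k + 1) (p - 1) (q - 1) s)) (at t)"
      by (simp add: W_def algebra_simps)
  qed
  finally show ?case
    by (simp add: p_def q_def s_def algebra_simps)
qed

lemma jacobi_eq_jacobi01:
  assumes "-1 < t" "t < 1"
  shows "jacobi n p q t = jacobi01 (int n) p q ((t + 1) / 2)"
proof -
  have "(-1 :: real) ^ n * (-2) ^ n = 2 ^ n"
    by (simp flip: power_mult_distrib)
  then show ?thesis
    unfolding jacobi_def Rodrigues_iterate[OF assms]
    using assms by (simp add: powr_minus field_simps)
qed

section \<open>Separation of variables\<close>

text \<open>
  Integer powers in place of \<open>nat\<close> turn a shift of an index into multiplication by \<open>1 - x\<close> or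
  \<open>1 - x - y\<close> or the reciprocal, also when the shifted index is \<open>-1\<close>: there the Jacobi factor vanishes.
\<close>
definition P6_factored where
  "P6_factored m1 m2 m3 p1 q1 p2 q2 p3 q3 x y z =
     jacobi01 m1 p1 q1 x * (1 - x) powi m2 * jacobi01 m2 p2 q2 (y / (1 - x)) *
     (1 - x - y) powi m3 * jacobi01 m3 p3 q3 (z / (1 - x - y))"

lemma P6_eq_factored:
  assumes "(x, y, z) \<in> simplex3"
  shows "P6 m1 m2 m3 \<alpha> \<beta> \<gamma> \<delta> a b x y z =
     P6_factored m1 m2 m3 (\<beta> + \<gamma> + \<delta> + a + b + 2 * of_int m2 + 2 * of_int m3 + 2) \<alpha>
       (\<gamma> + \<delta> + 2 * of_int m3 + b + 1) \<beta> \<delta> \<gamma> x y z"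
proof -
  have pos: "x > 0" "y > 0" "z > 0" "x + y + z < 1"
    using assms by (auto simp: simplex3_def)
  have rng: "-1 < 2 * x - 1" "2 * x - 1 < 1" "-1 < 2 * y / (1 - x) - 1" "2 * y / (1 - x) - 1 < 1"
     "-1 < 2 * z / (1 - x - y) - 1" "2 * z / (1 - x - y) - 1 < 1"
    using pos by (auto simp: field_simps)
  show ?thesis
  proof (cases "m1 < 0 \<or> m2 < 0 \<or> m3 < 0")
    case True
    then show ?thesis
      by (auto simp: P6_def P6_factored_def jacobi01_def)
  next
    case False
    have "1 - x \<noteq> 0" "1 - x - y \<noteq> 0"
      using pos by auto
    then have arg: "(2 * x - 1 + 1) / 2 = x" "(2 * y / (1 - x) - 1 + 1) / 2 = y / (1 - x)"
       "(2 * z / (1 - x - y) - 1 + 1) / 2 = z / (1 - x - y)"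
      by (simp_all add: field_simps)
    from False show ?thesis
      by (simp only: P6_def P6_factored_def jacobi_eq_jacobi01 rng arg) (simp add: power_int_def)
  qed
qed

text \<open>
  The usual derivative with \<open>f x ^ (n - 1)\<close> written as \<open>f x ^ n / f x\<close>, which avoids treating
  \<open>n = 0\<close> separately.
\<close>
lemma DERIV_power_quotient:
  fixes f :: "real \<Rightarrow> real"
  assumes "(f has_real_derivative D) (at x)" "f x \<noteq> 0"
  shows "((\<lambda>x. f x ^ n) has_real_derivative real n * f x ^ n / f x * D) (at x)"
  by (rule DERIV_cong[OF DERIV_power[OF assms(1)]]) (use assms(2) in \<open>cases n; simp\<close>)

text \<open>
  The three base operators differentiate one Jacobi factor each. For \<open>N01\<close> the reason is that
  \<open>t = z / (1 - x - y)\<close> is constant along the vector field with components \<open>(0, 1, - z / (1 - x - y))\<close>;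
  for \<open>N10\<close>, both \<open>s = y / (1 - x)\<close> and \<open>t\<close> are constant along
  \<open>(1, - y / (1 - x), - z / (1 - x))\<close>. The zeroth-order terms cancel the derivatives of the powers of
  \<open>1 - x\<close> and \<open>1 - x - y\<close>.
\<close>
lemma P6_base_operators:
  fixes n1 n2 n3 :: nat
  assumes xyz: "(x, y, z) \<in> simplex3"
    and u: "u = P6 (int n1) (int n2) (int n3) \<alpha> \<beta> \<gamma> \<delta> a b"
    and p1: "p1 = \<beta> + \<gamma> + \<delta> + a + b + 2 * real n2 + 2 * real n3 + 2"
    and p2: "p2 = \<gamma> + \<delta> + 2 * real n3 + b + 1"
    and c: "c = 1 - x" and d: "d = 1 - x - y"
    and F: "F = jacobi01 n1 p1 \<alpha> x" and G: "G = jacobi01 n2 p2 \<beta> (y / c)"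
    and H: "H = jacobi01 n3 \<delta> \<gamma> (z / d)"
  shows "u x y z = F * c ^ n2 * G * d ^ n3 * H"
    and "O10 n1 n2 n3 \<alpha> \<beta> \<gamma> \<delta> a b u x y z = F * c ^ n2 * G * d ^ n3 * (jacobi01' n3 \<delta> \<gamma> (z / d) / d)"
    and "N01 n1 n2 n3 \<alpha> \<beta> \<gamma> \<delta> a b u x y z = F * c ^ n2 * (jacobi01' n2 p2 \<beta> (y / c) / c) * d ^ n3 * H"
    and "N10 n1 n2 n3 \<alpha> \<beta> \<gamma> \<delta> a b u x y z = jacobi01' n1 p1 \<alpha> x * c ^ n2 * G * d ^ n3 * H"
proof -
  have pos: "x > 0" "y > 0" "z > 0" "x + y + z < 1"
    using xyz by (auto simp: simplex3_def)
  define f where "f = (\<lambda>x y z. jacobi01 n1 p1 \<alpha> x * (1 - x) ^ n2 * jacobi01 n2 p2 \<beta> (y / (1 - x)) *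
    (1 - x - y) ^ n3 * jacobi01 n3 \<delta> \<gamma> (z / (1 - x - y)))"
  have uf: "u x y z = f x y z" if "(x, y, z) \<in> simplex3" for x y z
    unfolding u P6_eq_factored[OF that] by (simp add: P6_factored_def f_def p1 p2)
  show "u x y z = F * c ^ n2 * G * d ^ n3 * H"
    using xyz by (simp add: uf f_def F G H c d)
  define F' where "F' = jacobi01' n1 p1 \<alpha> x"
  define G' where "G' = jacobi01' n2 p2 \<beta> (y / c)"
  define H' where "H' = jacobi01' n3 \<delta> \<gamma> (z / d)"
  have nz: "c \<noteq> 0" "d \<noteq> 0" "1 - x \<noteq> 0" "1 - x - y \<noteq> 0"
    using pos by (auto simp: c d)

  \<comment> \<open>The separated form holds on the simplex only, whose sections parallel to the axes are open
    intervals; it may therefore be differentiated in place of \<open>u\<close>.\<close>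
  have near: "eventually P (nhds s0)" if "\<And>s. s \<in> {l<..<r} \<Longrightarrow> P s" "l < s0" "s0 < r" for P and l r s0 :: real
    using that eventually_nhds_in_open[of "{l<..<r}" s0] by (auto elim!: eventually_mono)
  note intros = DERIV_mult DERIV_chain2[OF DERIV_jacobi01] DERIV_power_quotient

  have "pdz u x y z = deriv (\<lambda>s. f x y s) z"
    unfolding pdz_def
    by (rule deriv_cong_ev[OF near[of 0 "1 - x - y"]]) (use pos in \<open>auto simp: uf simplex3_def\<close>)
  also have "\<dots> = F * c ^ n2 * G * d ^ n3 * (H' / d)"
  proof (rule DERIV_imp_deriv)
    have "((\<lambda>s. s / (1 - x - y)) has_real_derivative 1 / d) (at z)"
      using nz by (auto intro!: derivative_eq_intros simp: d)
    from DERIV_cmult[OF DERIV_chain2[OF DERIV_jacobi01 this]]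
    show "((\<lambda>s. f x y s) has_real_derivative F * c ^ n2 * G * d ^ n3 * (H' / d)) (at z)"
      unfolding f_def F G H H'_def c d by simp
  qed
  finally have pdz: "pdz u x y z = F * c ^ n2 * G * d ^ n3 * (H' / d)" .
  then show "O10 n1 n2 n3 \<alpha> \<beta> \<gamma> \<delta> a b u x y z = F * c ^ n2 * G * d ^ n3 * (jacobi01' n3 \<delta> \<gamma> (z / d) / d)"
    by (simp add: O10_def H'_def)

  have "pdy u x y z = deriv (\<lambda>s. f x s z) y"
    unfolding pdy_def
    by (rule deriv_cong_ev[OF near[of 0 "1 - x - z"]]) (use pos in \<open>auto simp: uf simplex3_def\<close>)
  also have "\<dots> = F * c ^ n2 * ((G' / c) * (d ^ n3 * H) + G * (d ^ n3 * (H' * (z / d\<^sup>2)) - n3 * d ^ n3 / d * H))"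
  proof (rule DERIV_imp_deriv)
    have "((\<lambda>s. s / (1 - x)) has_real_derivative 1 / c) (at y)"
      using nz by (auto intro!: derivative_eq_intros simp: c)
    note dG = DERIV_chain2[OF DERIV_jacobi01 this]
    have "((\<lambda>s. z / (1 - x - s)) has_real_derivative z / d\<^sup>2) (at y)"
      using nz by (auto intro!: derivative_eq_intros simp: d power2_eq_square)
    note dH = DERIV_chain2[OF DERIV_jacobi01 this]
    have "((\<lambda>s. (1 - x - s)) has_real_derivative - 1) (at y)"
      by (auto intro!: derivative_eq_intros)
    note dD = DERIV_power_quotient[OF this nz(4), of n3]
    show "((\<lambda>s. f x s z) has_real_derivative F * c ^ n2 * ((G' / c) * (d ^ n3 * H) +
        G * (d ^ n3 * (H' * (z / d\<^sup>2)) - n3 * d ^ n3 / d * H))) (at y)"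
      using DERIV_cmult[OF DERIV_mult[OF dG DERIV_mult[OF dD dH]], of "F * c ^ n2" n2 p2 \<beta> n3 \<delta> \<gamma>]
      unfolding f_def F G H G'_def H'_def c d by (simp add: mult.assoc algebra_simps)
  qed
  finally have pdy: "pdy u x y z = F * c ^ n2 * ((G' / c) * (d ^ n3 * H) +
        G * (d ^ n3 * (H' * (z / d\<^sup>2)) - n3 * d ^ n3 / d * H))" .
  show "N01 n1 n2 n3 \<alpha> \<beta> \<gamma> \<delta> a b u x y z = F * c ^ n2 * (jacobi01' n2 p2 \<beta> (y / c) / c) * d ^ n3 * H"
    unfolding N01_def pdy pdz \<open>u x y z = _\<close> G'_def [symmetric] d [symmetric]
    using nz by (simp add: field_simps power2_eq_square)

  have "pdx u x y z = deriv (\<lambda>s. f s y z) x"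
    unfolding pdx_def
    by (rule deriv_cong_ev[OF near[of 0 "1 - y - z"]]) (use pos in \<open>auto simp: uf simplex3_def\<close>)
  also have "\<dots> = F' * c ^ n2 * G * d ^ n3 * H - F * (n2 * c ^ n2 / c) * G * d ^ n3 * H
      + F * c ^ n2 * (G' * (y / c\<^sup>2)) * d ^ n3 * H - F * c ^ n2 * G * (n3 * d ^ n3 / d) * H
      + F * c ^ n2 * G * d ^ n3 * (H' * (z / d\<^sup>2))"
  proof (rule DERIV_imp_deriv)
    have "((\<lambda>s. y / (1 - s)) has_real_derivative y / c\<^sup>2) (at x)"
      using nz by (auto intro!: derivative_eq_intros simp: c power2_eq_square)
    note dG = DERIV_chain2[OF DERIV_jacobi01 this]
    have "((\<lambda>s. z / (1 - s - y)) has_real_derivative z / d\<^sup>2) (at x)"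
      using nz by (auto intro!: derivative_eq_intros simp: d power2_eq_square)
    note dH = DERIV_chain2[OF DERIV_jacobi01 this]
    have "((\<lambda>s. (1 - s)) has_real_derivative - 1) (at x)"
      by (auto intro!: derivative_eq_intros)
    note dC = DERIV_power_quotient[OF this nz(3), of n2]
    have "((\<lambda>s. (1 - s - y)) has_real_derivative - 1) (at x)"
      by (auto intro!: derivative_eq_intros)
    note dD = DERIV_power_quotient[OF this nz(4), of n3]
    show "((\<lambda>s. f s y z) has_real_derivative
      F' * c ^ n2 * G * d ^ n3 * H - F * (n2 * c ^ n2 / c) * G * d ^ n3 * H
      + F * c ^ n2 * (G' * (y / c\<^sup>2)) * d ^ n3 * H - F * c ^ n2 * G * (n3 * d ^ n3 / d) * H
      + F * c ^ n2 * G * d ^ n3 * (H' * (z / d\<^sup>2))) (at x)"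
      using DERIV_mult[OF DERIV_mult[OF DERIV_mult[OF DERIV_mult[OF DERIV_jacobi01 dC] dG] dD] dH,
          of n1 p1 \<alpha> n2 p2 \<beta> n3 \<delta> \<gamma>]
      unfolding f_def F G H F'_def G'_def H'_def c d by (simp add: algebra_simps)
  qed
  finally have pdx: "pdx u x y z = F' * c ^ n2 * G * d ^ n3 * H - F * (n2 * c ^ n2 / c) * G * d ^ n3 * H
      + F * c ^ n2 * (G' * (y / c\<^sup>2)) * d ^ n3 * H - F * c ^ n2 * G * (n3 * d ^ n3 / d) * H
      + F * c ^ n2 * G * d ^ n3 * (H' * (z / d\<^sup>2))" .
  define U where "U = F * c ^ n2 * G * d ^ n3 * H"
  define V where "V = F * c ^ n2 * G * d ^ n3 * H'"
  define W where "W = F * c ^ n2 * G' * d ^ n3 * H"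
  have y: "y = c - d" by (simp add: c d)
  have "N10 n1 n2 n3 \<alpha> \<beta> \<gamma> \<delta> a b u x y z = (real n2 + real n3) / c * U +
      (F' * c ^ n2 * G * d ^ n3 * H - n2 / c * U + y / c\<^sup>2 * W - n3 / d * U + z / d\<^sup>2 * V)
      - y / c * (W / c + z / d\<^sup>2 * V - n3 / d * U) - z / c * (V / d)"
    unfolding N10_def pdx pdy pdz \<open>u x y z = _\<close> c [symmetric] U_def V_def W_def by (simp add: algebra_simps)
  also have "\<dots> = F' * c ^ n2 * G * d ^ n3 * H"
    unfolding y using nz(1,2) by (simp add: field_simps power2_eq_square)
  finally show "N10 n1 n2 n3 \<alpha> \<beta> \<gamma> \<delta> a b u x y z = jacobi01' n1 p1 \<alpha> x * c ^ n2 * G * d ^ n3 * H"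
    by (simp add: F'_def)
qed

section \<open>Reduction of each family to its base operator\<close>

text \<open>
  These hold for an arbitrary function \<open>u\<close>. The multiplier \<open>p\<close> is the first parameter of the second
  Jacobi factor, so that after the substitution \<open>y = c s\<close>, \<open>d = c (1 - s)\<close> the right-hand sides become the
  left-hand sides of the one-variable relations, up to a power of \<open>c\<close>.
\<close>
lemma N0i_via_N01:
  fixes c d :: real
  assumes c: "c = 1 - x" and d: "d = 1 - x - y" and nz: "c \<noteq> 0" "d \<noteq> 0"
    and v: "v = u x y z" and K: "K = N01 n1 n2 n3 \<alpha> \<beta> \<gamma> \<delta> a b u x y z"
    and p: "p = \<gamma> + \<delta> + 2 * real n3 + b + 1"
  shows "N01_plus n1 n2 n3 \<alpha> \<beta> \<gamma> \<delta> a b u x y z = (y * p - d * \<beta>) * v - y * d * K"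
    and "N02 n1 n2 n3 \<alpha> \<beta> \<gamma> \<delta> a b u x y z = (real n2 + p + \<beta> + 1) * v + y * K"
    and "N02_plus n1 n2 n3 \<alpha> \<beta> \<gamma> \<delta> a b u x y z = (p + real n2 * d / c) * v - y * d / c * K"
    and "N03 n1 n2 n3 \<alpha> \<beta> \<gamma> \<delta> a b u x y z = (real n2 + p + \<beta> + 1) * v - d * K"
    and "N03_plus n1 n2 n3 \<alpha> \<beta> \<gamma> \<delta> a b u x y z = (\<beta> + real n2 * y / c) * v + y * d / c * K"
    and "N04 n1 n2 n3 \<alpha> \<beta> \<gamma> \<delta> a b u x y z = (y * p - d * (\<beta> + real n2 + 1)) * v - y * d * K"
    and "N04_plus n1 n2 n3 \<alpha> \<beta> \<gamma> \<delta> a b u x y z = - real n2 / c * v + y / c * K"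
    and "N05 n1 n2 n3 \<alpha> \<beta> \<gamma> \<delta> a b u x y z = ((p + real n2 + 1) * y - d * \<beta>) * v - y * d * K"
    and "N05_plus n1 n2 n3 \<alpha> \<beta> \<gamma> \<delta> a b u x y z = real n2 / c * v + d / c * K"
    and "N06 n1 n2 n3 \<alpha> \<beta> \<gamma> \<delta> a b u x y z = \<beta> * v + y * K"
    and "N06_plus n1 n2 n3 \<alpha> \<beta> \<gamma> \<delta> a b u x y z = p * v - d * K"
proof -
  define Uy Uz where "Uy = pdy u x y z" and "Uz = pdz u x y z"
  have y: "y = c - d" and cy: "c - y = d" by (simp_all add: c d)
  have K: "K = real n3 / d * v + Uy - z / d * Uz"
    by (simp add: K N01_def d v Uy_def Uz_def)
  note defs = v [symmetric] Uy_def [symmetric] Uz_def [symmetric] c [symmetric] cy p K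
  show "N01_plus n1 n2 n3 \<alpha> \<beta> \<gamma> \<delta> a b u x y z = (y * p - d * \<beta>) * v - y * d * K"
    unfolding N01_plus_def defs using nz by (simp add: field_simps)
  show "N02 n1 n2 n3 \<alpha> \<beta> \<gamma> \<delta> a b u x y z = (real n2 + p + \<beta> + 1) * v + y * K"
    unfolding N02_def defs using nz by (simp add: field_simps)
  show "N02_plus n1 n2 n3 \<alpha> \<beta> \<gamma> \<delta> a b u x y z = (p + real n2 * d / c) * v - y * d / c * K"
    unfolding N02_plus_def defs using nz unfolding y by (simp add: field_simps)
  show "N03 n1 n2 n3 \<alpha> \<beta> \<gamma> \<delta> a b u x y z = (real n2 + p + \<beta> + 1) * v - d * K"
    unfolding N03_def defs using nz by (simp add: field_simps)
  show "N03_plus n1 n2 n3 \<alpha> \<beta> \<gamma> \<delta> a b u x y z = (\<beta> + real n2 * y / c) * v + y * d / c * K"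
    unfolding N03_plus_def defs using nz by (simp add: field_simps)
  show "N04 n1 n2 n3 \<alpha> \<beta> \<gamma> \<delta> a b u x y z = (y * p - d * (\<beta> + real n2 + 1)) * v - y * d * K"
    unfolding N04_def defs using nz by (simp add: field_simps)
  show "N04_plus n1 n2 n3 \<alpha> \<beta> \<gamma> \<delta> a b u x y z = - real n2 / c * v + y / c * K"
    unfolding N04_plus_def defs using nz by (simp add: field_simps)
  show "N05 n1 n2 n3 \<alpha> \<beta> \<gamma> \<delta> a b u x y z = ((p + real n2 + 1) * y - d * \<beta>) * v - y * d * K"
    unfolding N05_def defs using nz by (simp add: field_simps)
  show "N05_plus n1 n2 n3 \<alpha> \<beta> \<gamma> \<delta> a b u x y z = real n2 / c * v + d / c * K"
    unfolding N05_plus_def defs using nz unfolding y by (simp add: field_simps)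
  show "N06 n1 n2 n3 \<alpha> \<beta> \<gamma> \<delta> a b u x y z = \<beta> * v + y * K"
    unfolding N06_def defs using nz by (simp add: field_simps)
  show "N06_plus n1 n2 n3 \<alpha> \<beta> \<gamma> \<delta> a b u x y z = p * v - d * K"
    unfolding N06_plus_def defs using nz by (simp add: field_simps)
qed

text \<open>
  Here \<open>p\<close> is the first parameter of the first Jacobi factor, and \<open>x\<close> itself is the variable.
\<close>
lemma Ni0_via_N10:
  fixes c :: real
  assumes c: "c = 1 - x" and nz: "c \<noteq> 0"
    and v: "v = u x y z" and K: "K = N10 n1 n2 n3 \<alpha> \<beta> \<gamma> \<delta> a b u x y z"
    and p: "p = \<beta> + \<gamma> + \<delta> + a + b + 2 * real n2 + 2 * real n3 + 2"
  shows "N10_plus n1 n2 n3 \<alpha> \<beta> \<gamma> \<delta> a b u x y z = (x * p - c * \<alpha>) * v - x * c * K"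
    and "N20 n1 n2 n3 \<alpha> \<beta> \<gamma> \<delta> a b u x y z = (real n1 + p + \<alpha> + 1) * v + x * K"
    and "N20_plus n1 n2 n3 \<alpha> \<beta> \<gamma> \<delta> a b u x y z = (p + real n1 * c) * v - x * c * K"
    and "N30 n1 n2 n3 \<alpha> \<beta> \<gamma> \<delta> a b u x y z = (real n1 + p + \<alpha> + 1) * v - c * K"
    and "N30_plus n1 n2 n3 \<alpha> \<beta> \<gamma> \<delta> a b u x y z = (\<alpha> + real n1 * x) * v + x * c * K"
    and "N40 n1 n2 n3 \<alpha> \<beta> \<gamma> \<delta> a b u x y z = (x * p - c * (\<alpha> + real n1 + 1)) * v - x * c * K"
    and "N40_plus n1 n2 n3 \<alpha> \<beta> \<gamma> \<delta> a b u x y z = - real n1 * v + x * K"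
    and "N50 n1 n2 n3 \<alpha> \<beta> \<gamma> \<delta> a b u x y z = ((p + real n1 + 1) * x - c * \<alpha>) * v - x * c * K"
    and "N50_plus n1 n2 n3 \<alpha> \<beta> \<gamma> \<delta> a b u x y z = real n1 * v + c * K"
    and "N60 n1 n2 n3 \<alpha> \<beta> \<gamma> \<delta> a b u x y z = \<alpha> * v + x * K"
    and "N60_plus n1 n2 n3 \<alpha> \<beta> \<gamma> \<delta> a b u x y z = p * v - c * K"
proof -
  define Ux Uy Uz where "Ux = pdx u x y z" and "Uy = pdy u x y z" and "Uz = pdz u x y z"
  have x: "x = 1 - c" by (simp add: c)
  have K: "K = (real n2 + real n3) / c * v + Ux - y / c * Uy - z / c * Uz"
    by (simp add: K N10_def c v Ux_def Uy_def Uz_def)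
  note defs = v [symmetric] Ux_def [symmetric] Uy_def [symmetric] Uz_def [symmetric] c [symmetric] p K
    Let_def of_nat_add
  show "N10_plus n1 n2 n3 \<alpha> \<beta> \<gamma> \<delta> a b u x y z = (x * p - c * \<alpha>) * v - x * c * K"
    unfolding N10_plus_def defs using nz unfolding x by (simp add: field_simps)
  show "N20 n1 n2 n3 \<alpha> \<beta> \<gamma> \<delta> a b u x y z = (real n1 + p + \<alpha> + 1) * v + x * K"
    unfolding N20_def defs using nz by (simp add: field_simps)
  show "N20_plus n1 n2 n3 \<alpha> \<beta> \<gamma> \<delta> a b u x y z = (p + real n1 * c) * v - x * c * K"
    unfolding N20_plus_def defs using nz unfolding x by (simp add: field_simps)
  show "N30 n1 n2 n3 \<alpha> \<beta> \<gamma> \<delta> a b u x y z = (real n1 + p + \<alpha> + 1) * v - c * K"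
    unfolding N30_def defs using nz by (simp add: field_simps)
  show "N30_plus n1 n2 n3 \<alpha> \<beta> \<gamma> \<delta> a b u x y z = (\<alpha> + real n1 * x) * v + x * c * K"
    unfolding N30_plus_def defs using nz by (simp add: field_simps)
  show "N40 n1 n2 n3 \<alpha> \<beta> \<gamma> \<delta> a b u x y z = (x * p - c * (\<alpha> + real n1 + 1)) * v - x * c * K"
    unfolding N40_def defs using nz unfolding x by (simp add: field_simps)
  show "N40_plus n1 n2 n3 \<alpha> \<beta> \<gamma> \<delta> a b u x y z = - real n1 * v + x * K"
    unfolding N40_plus_def defs using nz unfolding x by (simp add: field_simps)
  show "N50 n1 n2 n3 \<alpha> \<beta> \<gamma> \<delta> a b u x y z = ((p + real n1 + 1) * x - c * \<alpha>) * v - x * c * K"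
    unfolding N50_def defs using nz unfolding x by (simp add: field_simps)
  show "N50_plus n1 n2 n3 \<alpha> \<beta> \<gamma> \<delta> a b u x y z = real n1 * v + c * K"
    unfolding N50_plus_def defs using nz by (simp add: field_simps)
  show "N60 n1 n2 n3 \<alpha> \<beta> \<gamma> \<delta> a b u x y z = \<alpha> * v + x * K"
    unfolding N60_def defs using nz by (simp add: field_simps)
  show "N60_plus n1 n2 n3 \<alpha> \<beta> \<gamma> \<delta> a b u x y z = p * v - c * K"
    unfolding N60_plus_def defs using nz by (simp add: field_simps)
qed

section \<open>The three families of relations\<close>

text \<open>
  \<open>l = r * q\<close> will be a one-variable relation and \<open>A\<close> the product of the factors
  that the operator does not touch.
\<close>
lemma scaled_relation:
  fixes A :: real
  assumes "l = r * q" and "v = A * l"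
  shows "v = r * (A * q)"
  using assms by simp

lemma first_index_ladder:
  fixes n1 n2 n3 :: nat
  assumes xyz: "(x, y, z) \<in> simplex3"
    and u: "u = P6 (int n1) (int n2) (int n3) \<alpha> \<beta> \<gamma> \<delta> a b"
    and n: "n = n1 + n2 + n3" and e: "e = \<alpha> + \<beta> + \<gamma> + \<delta> + a + b"
  shows "N10 n1 n2 n3 \<alpha> \<beta> \<gamma> \<delta> a b u x y z =
       (real n + real n2 + real n3 + e + 3) *
       P6 (int n1 - 1) (int n2) (int n3) (\<alpha> + 1) \<beta> \<gamma> \<delta> (a + 1) b x y z"
    and "N10_plus n1 n2 n3 \<alpha> \<beta> \<gamma> \<delta> a b u x y z =
       (real n1 + 1) *
       P6 (int n1 + 1) (int n2) (int n3) (\<alpha> - 1) \<beta> \<gamma> \<delta> (a - 1) b x y z"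
    and "N20 n1 n2 n3 \<alpha> \<beta> \<gamma> \<delta> a b u x y z =
       (real n + real n2 + real n3 + e + 3) *
       P6 (int n1) (int n2) (int n3) \<alpha> \<beta> \<gamma> \<delta> (a + 1) b x y z"
    and "N20_plus n1 n2 n3 \<alpha> \<beta> \<gamma> \<delta> a b u x y z =
       (real n + real n2 + real n3 + e - \<alpha> + 2) *
       P6 (int n1) (int n2) (int n3) \<alpha> \<beta> \<gamma> \<delta> (a - 1) b x y z"
    and "N30 n1 n2 n3 \<alpha> \<beta> \<gamma> \<delta> a b u x y z =
       (real n + real n2 + real n3 + e + 3) *
       P6 (int n1) (int n2) (int n3) (\<alpha> + 1) \<beta> \<gamma> \<delta> a b x y z"
    and "N30_plus n1 n2 n3 \<alpha> \<beta> \<gamma> \<delta> a b u x y z =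
       (real n1 + \<alpha>) *
       P6 (int n1) (int n2) (int n3) (\<alpha> - 1) \<beta> \<gamma> \<delta> a b x y z"
    and "N40 n1 n2 n3 \<alpha> \<beta> \<gamma> \<delta> a b u x y z =
       (real n1 + 1) *
       P6 (int n1 + 1) (int n2) (int n3) \<alpha> \<beta> \<gamma> \<delta> (a - 1) b x y z"
    and "N40_plus n1 n2 n3 \<alpha> \<beta> \<gamma> \<delta> a b u x y z =
       (real n1 + \<alpha>) *
       P6 (int n1 - 1) (int n2) (int n3) \<alpha> \<beta> \<gamma> \<delta> (a + 1) b x y z"
    and "N50 n1 n2 n3 \<alpha> \<beta> \<gamma> \<delta> a b u x y z =
       (real n1 + 1) *
       P6 (int n1 + 1) (int n2) (int n3) (\<alpha> - 1) \<beta> \<gamma> \<delta> a b x y z"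
    and "N50_plus n1 n2 n3 \<alpha> \<beta> \<gamma> \<delta> a b u x y z =
       (real n + real n2 + real n3 + e - \<alpha> + 2) *
       P6 (int n1 - 1) (int n2) (int n3) (\<alpha> + 1) \<beta> \<gamma> \<delta> a b x y z"
    and "N60 n1 n2 n3 \<alpha> \<beta> \<gamma> \<delta> a b u x y z =
       (real n1 + \<alpha>) *
       P6 (int n1) (int n2) (int n3) (\<alpha> - 1) \<beta> \<gamma> \<delta> (a + 1) b x y z"
    and "N60_plus n1 n2 n3 \<alpha> \<beta> \<gamma> \<delta> a b u x y z =
       (real n + real n2 + real n3 + e - \<alpha> + 2) *
       P6 (int n1) (int n2) (int n3) (\<alpha> + 1) \<beta> \<gamma> \<delta> (a - 1) b x y z"
proof -
  define c d where "c = 1 - x" and "d = 1 - x - y"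
  have nz: "c \<noteq> 0"
    using xyz by (auto simp: c_def simplex3_def)
  define p where "p = \<beta> + \<gamma> + \<delta> + a + b + 2 * real n2 + 2 * real n3 + 2"
  define p2 where "p2 = \<gamma> + \<delta> + 2 * real n3 + b + 1"
  define J J' where "J = jacobi01 n1 p \<alpha> x" and "J' = jacobi01' n1 p \<alpha> x"
  define A where "A = c ^ n2 * jacobi01 n2 p2 \<beta> (y / c) * d ^ n3 * jacobi01 n3 \<delta> \<gamma> (z / d)"
  note base = P6_base_operators[OF xyz u p_def p2_def c_def d_def refl refl refl]
  have v: "A * J = u x y z" and K: "A * J' = N10 n1 n2 n3 \<alpha> \<beta> \<gamma> \<delta> a b u x y z"
    unfolding base(1,4) by (simp_all add: A_def J_def J'_def mult_ac)
  note ladder = Ni0_via_N10[OF c_def nz v K p_def]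
  have P6: "P6 m (int n2) (int n3) \<alpha>' \<beta> \<gamma> \<delta> a' b x y z = A * jacobi01 m (p + (a' - a)) \<alpha>' x" for m \<alpha>' a'
  proof -
    have "\<beta> + \<gamma> + \<delta> + a' + b + 2 * of_int (int n2) + 2 * of_int (int n3) + 2 = p + (a' - a)"
      by (simp add: p_def)
    then show ?thesis
      unfolding P6_eq_factored[OF xyz] P6_factored_def
      by (simp only: A_def c_def d_def p2_def mult_ac power_int_of_nat of_int_of_nat_eq)
  qed
  have coeff: "real n + real n2 + real n3 + e + 3 = real n1 + p + \<alpha> + 1"
     "real n + real n2 + real n3 + e - \<alpha> + 2 = real n1 + p"
    by (simp_all add: n e p_def)
  have param: "p + (a + 1 - a) = p + 1" "p + (a - 1 - a) = p - 1" "p + (a - a) = p"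
    by simp_all
  note L = jacobi01_ladder[where m = "int n1" and p = p and q = \<alpha> and s = x,
      unfolded of_int_of_nat_eq, folded J_def J'_def c_def]
  show "N10 n1 n2 n3 \<alpha> \<beta> \<gamma> \<delta> a b u x y z =
       (real n + real n2 + real n3 + e + 3) *
       P6 (int n1 - 1) (int n2) (int n3) (\<alpha> + 1) \<beta> \<gamma> \<delta> (a + 1) b x y z"
    unfolding K [symmetric] P6 coeff param
    by (rule scaled_relation[OF L(1)]) (simp add: algebra_simps)
  show "N10_plus n1 n2 n3 \<alpha> \<beta> \<gamma> \<delta> a b u x y z =
       (real n1 + 1) *
       P6 (int n1 + 1) (int n2) (int n3) (\<alpha> - 1) \<beta> \<gamma> \<delta> (a - 1) b x y z"
    unfolding ladder P6 coeff param
    by (rule scaled_relation[OF L(2)]) (simp add: algebra_simps)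
  show "N20 n1 n2 n3 \<alpha> \<beta> \<gamma> \<delta> a b u x y z =
       (real n + real n2 + real n3 + e + 3) *
       P6 (int n1) (int n2) (int n3) \<alpha> \<beta> \<gamma> \<delta> (a + 1) b x y z"
    unfolding ladder P6 coeff param
    by (rule scaled_relation[OF L(3)]) (simp add: algebra_simps)
  show "N20_plus n1 n2 n3 \<alpha> \<beta> \<gamma> \<delta> a b u x y z =
       (real n + real n2 + real n3 + e - \<alpha> + 2) *
       P6 (int n1) (int n2) (int n3) \<alpha> \<beta> \<gamma> \<delta> (a - 1) b x y z"
    unfolding ladder P6 coeff param
    by (rule scaled_relation[OF L(4)]) (simp add: algebra_simps)
  show "N30 n1 n2 n3 \<alpha> \<beta> \<gamma> \<delta> a b u x y z =
       (real n + real n2 + real n3 + e + 3) *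
       P6 (int n1) (int n2) (int n3) (\<alpha> + 1) \<beta> \<gamma> \<delta> a b x y z"
    unfolding ladder P6 coeff param
    by (rule scaled_relation[OF L(5)]) (simp add: algebra_simps)
  show "N30_plus n1 n2 n3 \<alpha> \<beta> \<gamma> \<delta> a b u x y z =
       (real n1 + \<alpha>) *
       P6 (int n1) (int n2) (int n3) (\<alpha> - 1) \<beta> \<gamma> \<delta> a b x y z"
    unfolding ladder P6 coeff param
    by (rule scaled_relation[OF L(6)]) (simp add: algebra_simps)
  show "N40 n1 n2 n3 \<alpha> \<beta> \<gamma> \<delta> a b u x y z =
       (real n1 + 1) *
       P6 (int n1 + 1) (int n2) (int n3) \<alpha> \<beta> \<gamma> \<delta> (a - 1) b x y z"
    unfolding ladder P6 coeff param
    by (rule scaled_relation[OF L(7)]) (simp add: algebra_simps)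
  show "N40_plus n1 n2 n3 \<alpha> \<beta> \<gamma> \<delta> a b u x y z =
       (real n1 + \<alpha>) *
       P6 (int n1 - 1) (int n2) (int n3) \<alpha> \<beta> \<gamma> \<delta> (a + 1) b x y z"
    unfolding ladder P6 coeff param
    by (rule scaled_relation[OF L(8)]) (simp add: algebra_simps)
  show "N50 n1 n2 n3 \<alpha> \<beta> \<gamma> \<delta> a b u x y z =
       (real n1 + 1) *
       P6 (int n1 + 1) (int n2) (int n3) (\<alpha> - 1) \<beta> \<gamma> \<delta> a b x y z"
    unfolding ladder P6 coeff param
    by (rule scaled_relation[OF L(9)]) (simp add: algebra_simps)
  show "N50_plus n1 n2 n3 \<alpha> \<beta> \<gamma> \<delta> a b u x y z =
       (real n + real n2 + real n3 + e - \<alpha> + 2) *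
       P6 (int n1 - 1) (int n2) (int n3) (\<alpha> + 1) \<beta> \<gamma> \<delta> a b x y z"
    unfolding ladder P6 coeff param
    by (rule scaled_relation[OF L(10)]) (simp add: algebra_simps)
  show "N60 n1 n2 n3 \<alpha> \<beta> \<gamma> \<delta> a b u x y z =
       (real n1 + \<alpha>) *
       P6 (int n1) (int n2) (int n3) (\<alpha> - 1) \<beta> \<gamma> \<delta> (a + 1) b x y z"
    unfolding ladder P6 coeff param
    by (rule scaled_relation[OF L(11)]) (simp add: algebra_simps)
  show "N60_plus n1 n2 n3 \<alpha> \<beta> \<gamma> \<delta> a b u x y z =
       (real n + real n2 + real n3 + e - \<alpha> + 2) *
       P6 (int n1) (int n2) (int n3) (\<alpha> + 1) \<beta> \<gamma> \<delta> (a - 1) b x y z"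
    unfolding ladder P6 coeff param
    by (rule scaled_relation[OF L(12)]) (simp add: algebra_simps)
qed

text \<open>
  A shift of \<open>n2\<close> also changes the power of \<open>1 - x\<close>, and the shifts of \<open>n2\<close>, \<open>\<beta>\<close>, \<open>a\<close> and \<open>b\<close> enter the
  first parameter of the first Jacobi factor; in each relation they cancel there.
\<close>
lemma second_index_ladder:
  fixes n1 n2 n3 :: nat
  assumes xyz: "(x, y, z) \<in> simplex3"
    and u: "u = P6 (int n1) (int n2) (int n3) \<alpha> \<beta> \<gamma> \<delta> a b"
  shows "N01 n1 n2 n3 \<alpha> \<beta> \<gamma> \<delta> a b u x y z =
       (real n2 + 2 * real n3 + \<beta> + \<gamma> + \<delta> + b + 2) *
       P6 (int n1) (int n2 - 1) (int n3) \<alpha> (\<beta> + 1) \<gamma> \<delta> a (b + 1) x y z"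
    and "N01_plus n1 n2 n3 \<alpha> \<beta> \<gamma> \<delta> a b u x y z =
       (real n2 + 1) *
       P6 (int n1) (int n2 + 1) (int n3) \<alpha> (\<beta> - 1) \<gamma> \<delta> a (b - 1) x y z"
    and "N02 n1 n2 n3 \<alpha> \<beta> \<gamma> \<delta> a b u x y z =
       (real n2 + 2 * real n3 + \<beta> + \<gamma> + \<delta> + b + 2) *
       P6 (int n1) (int n2) (int n3) \<alpha> \<beta> \<gamma> \<delta> (a - 1) (b + 1) x y z"
    and "N02_plus n1 n2 n3 \<alpha> \<beta> \<gamma> \<delta> a b u x y z =
       (real n2 + 2 * real n3 + \<gamma> + \<delta> + b + 1) *
       P6 (int n1) (int n2) (int n3) \<alpha> \<beta> \<gamma> \<delta> (a + 1) (b - 1) x y z"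
    and "N03 n1 n2 n3 \<alpha> \<beta> \<gamma> \<delta> a b u x y z =
       (real n2 + 2 * real n3 + \<beta> + \<gamma> + \<delta> + b + 2) *
       P6 (int n1) (int n2) (int n3) \<alpha> (\<beta> + 1) \<gamma> \<delta> (a - 1) b x y z"
    and "N03_plus n1 n2 n3 \<alpha> \<beta> \<gamma> \<delta> a b u x y z =
       (real n2 + \<beta>) *
       P6 (int n1) (int n2) (int n3) \<alpha> (\<beta> - 1) \<gamma> \<delta> (a + 1) b x y z"
    and "N04 n1 n2 n3 \<alpha> \<beta> \<gamma> \<delta> a b u x y z =
       (real n2 + 1) *
       P6 (int n1) (int n2 + 1) (int n3) \<alpha> \<beta> \<gamma> \<delta> (a - 1) (b - 1) x y z"
    and "N04_plus n1 n2 n3 \<alpha> \<beta> \<gamma> \<delta> a b u x y z =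
       (real n2 + \<beta>) *
       P6 (int n1) (int n2 - 1) (int n3) \<alpha> \<beta> \<gamma> \<delta> (a + 1) (b + 1) x y z"
    and "N05 n1 n2 n3 \<alpha> \<beta> \<gamma> \<delta> a b u x y z =
       (real n2 + 1) *
       P6 (int n1) (int n2 + 1) (int n3) \<alpha> (\<beta> - 1) \<gamma> \<delta> (a - 1) b x y z"
    and "N05_plus n1 n2 n3 \<alpha> \<beta> \<gamma> \<delta> a b u x y z =
       (real n2 + 2 * real n3 + \<gamma> + \<delta> + b + 1) *
       P6 (int n1) (int n2 - 1) (int n3) \<alpha> (\<beta> + 1) \<gamma> \<delta> (a + 1) b x y z"
    and "N06 n1 n2 n3 \<alpha> \<beta> \<gamma> \<delta> a b u x y z =
       (real n2 + \<beta>) *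
       P6 (int n1) (int n2) (int n3) \<alpha> (\<beta> - 1) \<gamma> \<delta> a (b + 1) x y z"
    and "N06_plus n1 n2 n3 \<alpha> \<beta> \<gamma> \<delta> a b u x y z =
       (real n2 + 2 * real n3 + \<gamma> + \<delta> + b + 1) *
       P6 (int n1) (int n2) (int n3) \<alpha> (\<beta> + 1) \<gamma> \<delta> a (b - 1) x y z"
proof -
  define c d where "c = 1 - x" and "d = 1 - x - y"
  have nz: "c \<noteq> 0" "d \<noteq> 0"
    using xyz by (auto simp: c_def d_def simplex3_def)
  define p1 where "p1 = \<beta> + \<gamma> + \<delta> + a + b + 2 * real n2 + 2 * real n3 + 2"
  define p where "p = \<gamma> + \<delta> + 2 * real n3 + b + 1"
  define s where "s = y / c"
  have y: "y = c * s" and d: "d = c * (1 - s)"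
    using nz by (simp_all add: s_def c_def d_def field_simps)
  define J J' where "J = jacobi01 n2 p \<beta> s" and "J' = jacobi01' n2 p \<beta> s"
  define A where "A = jacobi01 n1 p1 \<alpha> x * c ^ n2 * d ^ n3 * jacobi01 n3 \<delta> \<gamma> (z / d)"
  note base = P6_base_operators[OF xyz u p1_def p_def c_def d_def refl refl refl]
  have v: "A * J = u x y z" and K: "A * J' / c = N01 n1 n2 n3 \<alpha> \<beta> \<gamma> \<delta> a b u x y z"
    unfolding base(1,3) by (simp_all add: A_def J_def J'_def s_def mult_ac)
  note ladder = N0i_via_N01[OF c_def d_def nz v K p_def]
  have P6: "P6 (int n1) m (int n3) \<alpha> \<beta>' \<gamma> \<delta> a' b' x y z =
      (A * c powi (m - int n2)) * jacobi01 m (p + (b' - b)) \<beta>' s"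
    if "(\<beta>' - \<beta>) + (a' - a) + (b' - b) + 2 * of_int (m - int n2) = 0" for m \<beta>' a' b'
  proof -
    have "\<beta>' + \<gamma> + \<delta> + a' + b' + 2 * of_int m + 2 * of_int (int n3) + 2 = p1"
      "\<gamma> + \<delta> + 2 * of_int (int n3) + b' + 1 = p + (b' - b)"
      using that by (simp_all add: p1_def p_def)
    moreover have "c powi m = c ^ n2 * c powi (m - int n2)"
      using nz by (simp add: power_int_diff)
    ultimately show ?thesis
      unfolding P6_eq_factored[OF xyz] P6_factored_def d_def [symmetric]
      unfolding c_def [symmetric] s_def [symmetric]
      by (simp only: A_def mult_ac power_int_of_nat)
  qed
  have coeff: "real n2 + 2 * real n3 + \<beta> + \<gamma> + \<delta> + b + 2 = real n2 + p + \<beta> + 1"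
     "real n2 + 2 * real n3 + \<gamma> + \<delta> + b + 1 = real n2 + p"
    by (simp_all add: p_def)
  have param: "p + (b + 1 - b) = p + 1" "p + (b - 1 - b) = p - 1" "p + (b - b) = p"
    by simp_all
  note L = jacobi01_ladder[where m = "int n2" and p = p and q = \<beta> and s = s,
      unfolded of_int_of_nat_eq, folded J_def J'_def]
  show "N01 n1 n2 n3 \<alpha> \<beta> \<gamma> \<delta> a b u x y z =
       (real n2 + 2 * real n3 + \<beta> + \<gamma> + \<delta> + b + 2) *
       P6 (int n1) (int n2 - 1) (int n3) \<alpha> (\<beta> + 1) \<gamma> \<delta> a (b + 1) x y z"
    unfolding K [symmetric] coeff
    by (subst P6, simp, unfold param, rule scaled_relation[OF L(1)]) (use nz(1) in \<open>simp add: y d field_simps\<close>)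
  show "N01_plus n1 n2 n3 \<alpha> \<beta> \<gamma> \<delta> a b u x y z =
       (real n2 + 1) *
       P6 (int n1) (int n2 + 1) (int n3) \<alpha> (\<beta> - 1) \<gamma> \<delta> a (b - 1) x y z"
    unfolding ladder coeff
    by (subst P6, simp, unfold param, rule scaled_relation[OF L(2)]) (use nz(1) in \<open>simp add: y d field_simps\<close>)
  show "N02 n1 n2 n3 \<alpha> \<beta> \<gamma> \<delta> a b u x y z =
       (real n2 + 2 * real n3 + \<beta> + \<gamma> + \<delta> + b + 2) *
       P6 (int n1) (int n2) (int n3) \<alpha> \<beta> \<gamma> \<delta> (a - 1) (b + 1) x y z"
    unfolding ladder coeff
    by (subst P6, simp, unfold param, rule scaled_relation[OF L(3)]) (use nz(1) in \<open>simp add: y d field_simps\<close>)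
  show "N02_plus n1 n2 n3 \<alpha> \<beta> \<gamma> \<delta> a b u x y z =
       (real n2 + 2 * real n3 + \<gamma> + \<delta> + b + 1) *
       P6 (int n1) (int n2) (int n3) \<alpha> \<beta> \<gamma> \<delta> (a + 1) (b - 1) x y z"
    unfolding ladder coeff
    by (subst P6, simp, unfold param, rule scaled_relation[OF L(4)]) (use nz(1) in \<open>simp add: y d field_simps\<close>)
  show "N03 n1 n2 n3 \<alpha> \<beta> \<gamma> \<delta> a b u x y z =
       (real n2 + 2 * real n3 + \<beta> + \<gamma> + \<delta> + b + 2) *
       P6 (int n1) (int n2) (int n3) \<alpha> (\<beta> + 1) \<gamma> \<delta> (a - 1) b x y z"
    unfolding ladder coeff
    by (subst P6, simp, unfold param, rule scaled_relation[OF L(5)]) (use nz(1) in \<open>simp add: y d field_simps\<close>)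
  show "N03_plus n1 n2 n3 \<alpha> \<beta> \<gamma> \<delta> a b u x y z =
       (real n2 + \<beta>) *
       P6 (int n1) (int n2) (int n3) \<alpha> (\<beta> - 1) \<gamma> \<delta> (a + 1) b x y z"
    unfolding ladder coeff
    by (subst P6, simp, unfold param, rule scaled_relation[OF L(6)]) (use nz(1) in \<open>simp add: y d field_simps\<close>)
  show "N04 n1 n2 n3 \<alpha> \<beta> \<gamma> \<delta> a b u x y z =
       (real n2 + 1) *
       P6 (int n1) (int n2 + 1) (int n3) \<alpha> \<beta> \<gamma> \<delta> (a - 1) (b - 1) x y z"
    unfolding ladder coeff
    by (subst P6, simp, unfold param, rule scaled_relation[OF L(7)]) (use nz(1) in \<open>simp add: y d field_simps\<close>)
  show "N04_plus n1 n2 n3 \<alpha> \<beta> \<gamma> \<delta> a b u x y z =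
       (real n2 + \<beta>) *
       P6 (int n1) (int n2 - 1) (int n3) \<alpha> \<beta> \<gamma> \<delta> (a + 1) (b + 1) x y z"
    unfolding ladder coeff
    by (subst P6, simp, unfold param, rule scaled_relation[OF L(8)]) (use nz(1) in \<open>simp add: y d field_simps\<close>)
  show "N05 n1 n2 n3 \<alpha> \<beta> \<gamma> \<delta> a b u x y z =
       (real n2 + 1) *
       P6 (int n1) (int n2 + 1) (int n3) \<alpha> (\<beta> - 1) \<gamma> \<delta> (a - 1) b x y z"
    unfolding ladder coeff
    by (subst P6, simp, unfold param, rule scaled_relation[OF L(9)]) (use nz(1) in \<open>simp add: y d field_simps\<close>)
  show "N05_plus n1 n2 n3 \<alpha> \<beta> \<gamma> \<delta> a b u x y z =
       (real n2 + 2 * real n3 + \<gamma> + \<delta> + b + 1) *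
       P6 (int n1) (int n2 - 1) (int n3) \<alpha> (\<beta> + 1) \<gamma> \<delta> (a + 1) b x y z"
    unfolding ladder coeff
    by (subst P6, simp, unfold param, rule scaled_relation[OF L(10)]) (use nz(1) in \<open>simp add: y d field_simps\<close>)
  show "N06 n1 n2 n3 \<alpha> \<beta> \<gamma> \<delta> a b u x y z =
       (real n2 + \<beta>) *
       P6 (int n1) (int n2) (int n3) \<alpha> (\<beta> - 1) \<gamma> \<delta> a (b + 1) x y z"
    unfolding ladder coeff
    by (subst P6, simp, unfold param, rule scaled_relation[OF L(11)]) (use nz(1) in \<open>simp add: y d field_simps\<close>)
  show "N06_plus n1 n2 n3 \<alpha> \<beta> \<gamma> \<delta> a b u x y z =
       (real n2 + 2 * real n3 + \<gamma> + \<delta> + b + 1) *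
       P6 (int n1) (int n2) (int n3) \<alpha> (\<beta> + 1) \<gamma> \<delta> a (b - 1) x y z"
    unfolding ladder coeff
    by (subst P6, simp, unfold param, rule scaled_relation[OF L(12)]) (use nz(1) in \<open>simp add: y d field_simps\<close>)
qed

text \<open>
  In each relation the shifts of \<open>n3\<close>, \<open>\<gamma>\<close>, \<open>\<delta>\<close> and \<open>b\<close> cancel in the first parameters of both other
  Jacobi factors.
\<close>
lemma third_index_ladder:
  fixes n1 n2 n3 :: nat
  assumes xyz: "(x, y, z) \<in> simplex3"
    and u: "u = P6 (int n1) (int n2) (int n3) \<alpha> \<beta> \<gamma> \<delta> a b"
  shows "O10 n1 n2 n3 \<alpha> \<beta> \<gamma> \<delta> a b u x y z =
       (real n3 + \<delta> + \<gamma> + 1) *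
       P6 (int n1) (int n2) (int n3 - 1) \<alpha> \<beta> (\<gamma> + 1) (\<delta> + 1) a b x y z"
    and "O10_plus n1 n2 n3 \<alpha> \<beta> \<gamma> \<delta> a b u x y z =
       (real n3 + 1) *
       P6 (int n1) (int n2) (int n3 + 1) \<alpha> \<beta> (\<gamma> - 1) (\<delta> - 1) a b x y z"
    and "O20 n1 n2 n3 \<alpha> \<beta> \<gamma> \<delta> a b u x y z =
       (real n3 + \<delta> + \<gamma> + 1) *
       P6 (int n1) (int n2) (int n3) \<alpha> \<beta> \<gamma> (\<delta> + 1) a (b - 1) x y z"
    and "O20_plus n1 n2 n3 \<alpha> \<beta> \<gamma> \<delta> a b u x y z =
       (real n3 + \<delta>) *
       P6 (int n1) (int n2) (int n3) \<alpha> \<beta> \<gamma> (\<delta> - 1) a (b + 1) x y z"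
    and "O30 n1 n2 n3 \<alpha> \<beta> \<gamma> \<delta> a b u x y z =
       (real n3 + \<delta> + \<gamma> + 1) *
       P6 (int n1) (int n2) (int n3) \<alpha> \<beta> (\<gamma> + 1) \<delta> a (b - 1) x y z"
    and "O30_plus n1 n2 n3 \<alpha> \<beta> \<gamma> \<delta> a b u x y z =
       (real n3 + \<gamma>) *
       P6 (int n1) (int n2) (int n3) \<alpha> \<beta> (\<gamma> - 1) \<delta> a (b + 1) x y z"
    and "O40 n1 n2 n3 \<alpha> \<beta> \<gamma> \<delta> a b u x y z =
       (real n3 + 1) *
       P6 (int n1) (int n2) (int n3 + 1) \<alpha> \<beta> \<gamma> (\<delta> - 1) a (b - 1) x y z"
    and "O40_plus n1 n2 n3 \<alpha> \<beta> \<gamma> \<delta> a b u x y z =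
       (real n3 + \<gamma>) *
       P6 (int n1) (int n2) (int n3 - 1) \<alpha> \<beta> \<gamma> (\<delta> + 1) a (b + 1) x y z"
    and "O50 n1 n2 n3 \<alpha> \<beta> \<gamma> \<delta> a b u x y z =
       (real n3 + 1) *
       P6 (int n1) (int n2) (int n3 + 1) \<alpha> \<beta> (\<gamma> - 1) \<delta> a (b - 1) x y z"
    and "O50_plus n1 n2 n3 \<alpha> \<beta> \<gamma> \<delta> a b u x y z =
       (real n3 + \<delta>) *
       P6 (int n1) (int n2) (int n3 - 1) \<alpha> \<beta> (\<gamma> + 1) \<delta> a (b + 1) x y z"
    and "O60 n1 n2 n3 \<alpha> \<beta> \<gamma> \<delta> a b u x y z =
       (real n3 + \<gamma>) *
       P6 (int n1) (int n2) (int n3) \<alpha> \<beta> (\<gamma> - 1) (\<delta> + 1) a b x y z"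
    and "O60_plus n1 n2 n3 \<alpha> \<beta> \<gamma> \<delta> a b u x y z =
       (real n3 + \<delta>) *
       P6 (int n1) (int n2) (int n3) \<alpha> \<beta> (\<gamma> + 1) (\<delta> - 1) a b x y z"
proof -
  define c d where "c = 1 - x" and "d = 1 - x - y"
  have nz: "d \<noteq> 0"
    using xyz by (auto simp: d_def simplex3_def)
  define p1 where "p1 = \<beta> + \<gamma> + \<delta> + a + b + 2 * real n2 + 2 * real n3 + 2"
  define p2 where "p2 = \<gamma> + \<delta> + 2 * real n3 + b + 1"
  define t where "t = z / d"
  have z: "z = d * t"
    using nz by (simp add: t_def)
  define J J' where "J = jacobi01 n3 \<delta> \<gamma> t" and "J' = jacobi01' n3 \<delta> \<gamma> t"
  define A where "A = jacobi01 n1 p1 \<alpha> x * c ^ n2 * jacobi01 n2 p2 \<beta> (y / c) * d ^ n3"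
  note base = P6_base_operators[OF xyz u p1_def p2_def c_def d_def refl refl refl]
  have v: "u x y z = A * J" and K: "pdz u x y z = A * J' / d"
    unfolding base(1) base(2)[unfolded O10_def] by (simp_all add: A_def J_def J'_def t_def mult_ac)
  have P6: "P6 (int n1) (int n2) m \<alpha> \<beta> \<gamma>' \<delta>' a b' x y z =
      (A * d powi (m - int n3)) * jacobi01 m \<delta>' \<gamma>' t"
    if "(\<gamma>' - \<gamma>) + (\<delta>' - \<delta>) + (b' - b) + 2 * of_int (m - int n3) = 0" for m \<gamma>' \<delta>' b'
  proof -
    have "\<beta> + \<gamma>' + \<delta>' + a + b' + 2 * of_int (int n2) + 2 * of_int m + 2 = p1"
      "\<gamma>' + \<delta>' + 2 * of_int m + b' + 1 = p2"
      using that by (simp_all add: p1_def p2_def)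
    moreover have "d powi m = d ^ n3 * d powi (m - int n3)"
      using nz by (simp add: power_int_diff)
    ultimately show ?thesis
      unfolding P6_eq_factored[OF xyz] P6_factored_def d_def [symmetric]
      unfolding c_def [symmetric] t_def [symmetric]
      by (simp only: A_def mult_ac power_int_of_nat)
  qed
  note L = jacobi01_ladder[where m = "int n3" and p = \<delta> and q = \<gamma> and s = t,
      unfolded of_int_of_nat_eq, folded J_def J'_def]
  show "O10 n1 n2 n3 \<alpha> \<beta> \<gamma> \<delta> a b u x y z =
       (real n3 + \<delta> + \<gamma> + 1) *
       P6 (int n1) (int n2) (int n3 - 1) \<alpha> \<beta> (\<gamma> + 1) (\<delta> + 1) a b x y z"
    unfolding O10_def Let_def v K d_def [symmetric]
    by (subst P6, simp, rule scaled_relation[OF L(1)]) (use nz in \<open>simp add: z field_simps\<close>)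
  show "O10_plus n1 n2 n3 \<alpha> \<beta> \<gamma> \<delta> a b u x y z =
       (real n3 + 1) *
       P6 (int n1) (int n2) (int n3 + 1) \<alpha> \<beta> (\<gamma> - 1) (\<delta> - 1) a b x y z"
    unfolding O10_plus_def Let_def v K d_def [symmetric]
    by (subst P6, simp, rule scaled_relation[OF L(2)]) (use nz in \<open>simp add: z field_simps\<close>)
  show "O20 n1 n2 n3 \<alpha> \<beta> \<gamma> \<delta> a b u x y z =
       (real n3 + \<delta> + \<gamma> + 1) *
       P6 (int n1) (int n2) (int n3) \<alpha> \<beta> \<gamma> (\<delta> + 1) a (b - 1) x y z"
    unfolding O20_def Let_def v K d_def [symmetric]
    by (subst P6, simp, rule scaled_relation[OF L(3)]) (use nz in \<open>simp add: z field_simps\<close>)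
  show "O20_plus n1 n2 n3 \<alpha> \<beta> \<gamma> \<delta> a b u x y z =
       (real n3 + \<delta>) *
       P6 (int n1) (int n2) (int n3) \<alpha> \<beta> \<gamma> (\<delta> - 1) a (b + 1) x y z"
    unfolding O20_plus_def Let_def v K d_def [symmetric]
    by (subst P6, simp, rule scaled_relation[OF L(4)]) (use nz in \<open>simp add: z field_simps\<close>)
  show "O30 n1 n2 n3 \<alpha> \<beta> \<gamma> \<delta> a b u x y z =
       (real n3 + \<delta> + \<gamma> + 1) *
       P6 (int n1) (int n2) (int n3) \<alpha> \<beta> (\<gamma> + 1) \<delta> a (b - 1) x y z"
    unfolding O30_def Let_def v K d_def [symmetric]
    by (subst P6, simp, rule scaled_relation[OF L(5)]) (use nz in \<open>simp add: z field_simps\<close>)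
  show "O30_plus n1 n2 n3 \<alpha> \<beta> \<gamma> \<delta> a b u x y z =
       (real n3 + \<gamma>) *
       P6 (int n1) (int n2) (int n3) \<alpha> \<beta> (\<gamma> - 1) \<delta> a (b + 1) x y z"
    unfolding O30_plus_def Let_def v K d_def [symmetric]
    by (subst P6, simp, rule scaled_relation[OF L(6)]) (use nz in \<open>simp add: z field_simps\<close>)
  show "O40 n1 n2 n3 \<alpha> \<beta> \<gamma> \<delta> a b u x y z =
       (real n3 + 1) *
       P6 (int n1) (int n2) (int n3 + 1) \<alpha> \<beta> \<gamma> (\<delta> - 1) a (b - 1) x y z"
    unfolding O40_def Let_def v K d_def [symmetric]
    by (subst P6, simp, rule scaled_relation[OF L(7)]) (use nz in \<open>simp add: z field_simps\<close>)
  show "O40_plus n1 n2 n3 \<alpha> \<beta> \<gamma> \<delta> a b u x y z =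
       (real n3 + \<gamma>) *
       P6 (int n1) (int n2) (int n3 - 1) \<alpha> \<beta> \<gamma> (\<delta> + 1) a (b + 1) x y z"
    unfolding O40_plus_def Let_def v K d_def [symmetric]
    by (subst P6, simp, rule scaled_relation[OF L(8)]) (use nz in \<open>simp add: z field_simps\<close>)
  show "O50 n1 n2 n3 \<alpha> \<beta> \<gamma> \<delta> a b u x y z =
       (real n3 + 1) *
       P6 (int n1) (int n2) (int n3 + 1) \<alpha> \<beta> (\<gamma> - 1) \<delta> a (b - 1) x y z"
    unfolding O50_def Let_def v K d_def [symmetric]
    by (subst P6, simp, rule scaled_relation[OF L(9)]) (use nz in \<open>simp add: z field_simps\<close>)
  show "O50_plus n1 n2 n3 \<alpha> \<beta> \<gamma> \<delta> a b u x y z =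
       (real n3 + \<delta>) *
       P6 (int n1) (int n2) (int n3 - 1) \<alpha> \<beta> (\<gamma> + 1) \<delta> a (b + 1) x y z"
    unfolding O50_plus_def Let_def v K d_def [symmetric]
    by (subst P6, simp, rule scaled_relation[OF L(10)]) (use nz in \<open>simp add: z field_simps\<close>)
  show "O60 n1 n2 n3 \<alpha> \<beta> \<gamma> \<delta> a b u x y z =
       (real n3 + \<gamma>) *
       P6 (int n1) (int n2) (int n3) \<alpha> \<beta> (\<gamma> - 1) (\<delta> + 1) a b x y z"
    unfolding O60_def Let_def v K d_def [symmetric]
    by (subst P6, simp, rule scaled_relation[OF L(11)]) (use nz in \<open>simp add: z field_simps\<close>)
  show "O60_plus n1 n2 n3 \<alpha> \<beta> \<gamma> \<delta> a b u x y z =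
       (real n3 + \<delta>) *
       P6 (int n1) (int n2) (int n3) \<alpha> \<beta> (\<gamma> + 1) (\<delta> - 1) a b x y z"
    unfolding O60_plus_def Let_def v K d_def [symmetric]
    by (subst P6, simp, rule scaled_relation[OF L(12)]) (use nz in \<open>simp add: z field_simps\<close>)
qed

theorem theorem1:
  fixes n1 n2 n3 n :: nat
    and \<alpha> \<beta> \<gamma> \<delta> a b e x y z :: real
    and u :: "real \<Rightarrow> real \<Rightarrow> real \<Rightarrow> real"
  assumes "n = n1 + n2 + n3"
    and "e = \<alpha> + \<beta> + \<gamma> + \<delta> + a + b"
    and "u = P6 (int n1) (int n2) (int n3) \<alpha> \<beta> \<gamma> \<delta> a b"
    and "(x, y, z) \<in> simplex3"
  shows
    "N01 n1 n2 n3 \<alpha> \<beta> \<gamma> \<delta> a b u x y z =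
       (real n2 + 2 * real n3 + \<beta> + \<gamma> + \<delta> + b + 2) *
       P6 (int n1) (int n2 - 1) (int n3) \<alpha> (\<beta> + 1) \<gamma> \<delta> a (b + 1) x y z \<and>
     N01_plus n1 n2 n3 \<alpha> \<beta> \<gamma> \<delta> a b u x y z =
       (real n2 + 1) *
       P6 (int n1) (int n2 + 1) (int n3) \<alpha> (\<beta> - 1) \<gamma> \<delta> a (b - 1) x y z \<and>
     N02 n1 n2 n3 \<alpha> \<beta> \<gamma> \<delta> a b u x y z =
       (real n2 + 2 * real n3 + \<beta> + \<gamma> + \<delta> + b + 2) *
       P6 (int n1) (int n2) (int n3) \<alpha> \<beta> \<gamma> \<delta> (a - 1) (b + 1) x y z \<and>
     N02_plus n1 n2 n3 \<alpha> \<beta> \<gamma> \<delta> a b u x y z =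
       (real n2 + 2 * real n3 + \<gamma> + \<delta> + b + 1) *
       P6 (int n1) (int n2) (int n3) \<alpha> \<beta> \<gamma> \<delta> (a + 1) (b - 1) x y z \<and>
     N03 n1 n2 n3 \<alpha> \<beta> \<gamma> \<delta> a b u x y z =
       (real n2 + 2 * real n3 + \<beta> + \<gamma> + \<delta> + b + 2) *
       P6 (int n1) (int n2) (int n3) \<alpha> (\<beta> + 1) \<gamma> \<delta> (a - 1) b x y z \<and>
     N03_plus n1 n2 n3 \<alpha> \<beta> \<gamma> \<delta> a b u x y z =
       (real n2 + \<beta>) *
       P6 (int n1) (int n2) (int n3) \<alpha> (\<beta> - 1) \<gamma> \<delta> (a + 1) b x y z \<and>
     N04 n1 n2 n3 \<alpha> \<beta> \<gamma> \<delta> a b u x y z =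
       (real n2 + 1) *
       P6 (int n1) (int n2 + 1) (int n3) \<alpha> \<beta> \<gamma> \<delta> (a - 1) (b - 1) x y z \<and>
     N04_plus n1 n2 n3 \<alpha> \<beta> \<gamma> \<delta> a b u x y z =
       (real n2 + \<beta>) *
       P6 (int n1) (int n2 - 1) (int n3) \<alpha> \<beta> \<gamma> \<delta> (a + 1) (b + 1) x y z \<and>
     N05 n1 n2 n3 \<alpha> \<beta> \<gamma> \<delta> a b u x y z =
       (real n2 + 1) *
       P6 (int n1) (int n2 + 1) (int n3) \<alpha> (\<beta> - 1) \<gamma> \<delta> (a - 1) b x y z \<and>
     N05_plus n1 n2 n3 \<alpha> \<beta> \<gamma> \<delta> a b u x y z =
       (real n2 + 2 * real n3 + \<gamma> + \<delta> + b + 1) *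
       P6 (int n1) (int n2 - 1) (int n3) \<alpha> (\<beta> + 1) \<gamma> \<delta> (a + 1) b x y z \<and>
     N06 n1 n2 n3 \<alpha> \<beta> \<gamma> \<delta> a b u x y z =
       (real n2 + \<beta>) *
       P6 (int n1) (int n2) (int n3) \<alpha> (\<beta> - 1) \<gamma> \<delta> a (b + 1) x y z \<and>
     N06_plus n1 n2 n3 \<alpha> \<beta> \<gamma> \<delta> a b u x y z =
       (real n2 + 2 * real n3 + \<gamma> + \<delta> + b + 1) *
       P6 (int n1) (int n2) (int n3) \<alpha> (\<beta> + 1) \<gamma> \<delta> a (b - 1) x y z \<and>
     N10 n1 n2 n3 \<alpha> \<beta> \<gamma> \<delta> a b u x y z =
       (real n + real n2 + real n3 + e + 3) *
       P6 (int n1 - 1) (int n2) (int n3) (\<alpha> + 1) \<beta> \<gamma> \<delta> (a + 1) b x y z \<and>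
     N10_plus n1 n2 n3 \<alpha> \<beta> \<gamma> \<delta> a b u x y z =
       (real n1 + 1) *
       P6 (int n1 + 1) (int n2) (int n3) (\<alpha> - 1) \<beta> \<gamma> \<delta> (a - 1) b x y z \<and>
     N20 n1 n2 n3 \<alpha> \<beta> \<gamma> \<delta> a b u x y z =
       (real n + real n2 + real n3 + e + 3) *
       P6 (int n1) (int n2) (int n3) \<alpha> \<beta> \<gamma> \<delta> (a + 1) b x y z \<and>
     N20_plus n1 n2 n3 \<alpha> \<beta> \<gamma> \<delta> a b u x y z =
       (real n + real n2 + real n3 + e - \<alpha> + 2) *
       P6 (int n1) (int n2) (int n3) \<alpha> \<beta> \<gamma> \<delta> (a - 1) b x y z \<and>
     N30 n1 n2 n3 \<alpha> \<beta> \<gamma> \<delta> a b u x y z =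
       (real n + real n2 + real n3 + e + 3) *
       P6 (int n1) (int n2) (int n3) (\<alpha> + 1) \<beta> \<gamma> \<delta> a b x y z \<and>
     N30_plus n1 n2 n3 \<alpha> \<beta> \<gamma> \<delta> a b u x y z =
       (real n1 + \<alpha>) *
       P6 (int n1) (int n2) (int n3) (\<alpha> - 1) \<beta> \<gamma> \<delta> a b x y z \<and>
     N40 n1 n2 n3 \<alpha> \<beta> \<gamma> \<delta> a b u x y z =
       (real n1 + 1) *
       P6 (int n1 + 1) (int n2) (int n3) \<alpha> \<beta> \<gamma> \<delta> (a - 1) b x y z \<and>
     N40_plus n1 n2 n3 \<alpha> \<beta> \<gamma> \<delta> a b u x y z =
       (real n1 + \<alpha>) *
       P6 (int n1 - 1) (int n2) (int n3) \<alpha> \<beta> \<gamma> \<delta> (a + 1) b x y z \<and>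
     N50 n1 n2 n3 \<alpha> \<beta> \<gamma> \<delta> a b u x y z =
       (real n1 + 1) *
       P6 (int n1 + 1) (int n2) (int n3) (\<alpha> - 1) \<beta> \<gamma> \<delta> a b x y z \<and>
     N50_plus n1 n2 n3 \<alpha> \<beta> \<gamma> \<delta> a b u x y z =
       (real n + real n2 + real n3 + e - \<alpha> + 2) *
       P6 (int n1 - 1) (int n2) (int n3) (\<alpha> + 1) \<beta> \<gamma> \<delta> a b x y z \<and>
     N60 n1 n2 n3 \<alpha> \<beta> \<gamma> \<delta> a b u x y z =
       (real n1 + \<alpha>) *
       P6 (int n1) (int n2) (int n3) (\<alpha> - 1) \<beta> \<gamma> \<delta> (a + 1) b x y z \<and>
     N60_plus n1 n2 n3 \<alpha> \<beta> \<gamma> \<delta> a b u x y z =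
       (real n + real n2 + real n3 + e - \<alpha> + 2) *
       P6 (int n1) (int n2) (int n3) (\<alpha> + 1) \<beta> \<gamma> \<delta> (a - 1) b x y z \<and>
     O10 n1 n2 n3 \<alpha> \<beta> \<gamma> \<delta> a b u x y z =
       (real n3 + \<delta> + \<gamma> + 1) *
       P6 (int n1) (int n2) (int n3 - 1) \<alpha> \<beta> (\<gamma> + 1) (\<delta> + 1) a b x y z \<and>
     O10_plus n1 n2 n3 \<alpha> \<beta> \<gamma> \<delta> a b u x y z =
       (real n3 + 1) *
       P6 (int n1) (int n2) (int n3 + 1) \<alpha> \<beta> (\<gamma> - 1) (\<delta> - 1) a b x y z \<and>
     O20 n1 n2 n3 \<alpha> \<beta> \<gamma> \<delta> a b u x y z =
       (real n3 + \<delta> + \<gamma> + 1) *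
       P6 (int n1) (int n2) (int n3) \<alpha> \<beta> \<gamma> (\<delta> + 1) a (b - 1) x y z \<and>
     O20_plus n1 n2 n3 \<alpha> \<beta> \<gamma> \<delta> a b u x y z =
       (real n3 + \<delta>) *
       P6 (int n1) (int n2) (int n3) \<alpha> \<beta> \<gamma> (\<delta> - 1) a (b + 1) x y z \<and>
     O30 n1 n2 n3 \<alpha> \<beta> \<gamma> \<delta> a b u x y z =
       (real n3 + \<delta> + \<gamma> + 1) *
       P6 (int n1) (int n2) (int n3) \<alpha> \<beta> (\<gamma> + 1) \<delta> a (b - 1) x y z \<and>
     O30_plus n1 n2 n3 \<alpha> \<beta> \<gamma> \<delta> a b u x y z =
       (real n3 + \<gamma>) *
       P6 (int n1) (int n2) (int n3) \<alpha> \<beta> (\<gamma> - 1) \<delta> a (b + 1) x y z \<and>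
     O40 n1 n2 n3 \<alpha> \<beta> \<gamma> \<delta> a b u x y z =
       (real n3 + 1) *
       P6 (int n1) (int n2) (int n3 + 1) \<alpha> \<beta> \<gamma> (\<delta> - 1) a (b - 1) x y z \<and>
     O40_plus n1 n2 n3 \<alpha> \<beta> \<gamma> \<delta> a b u x y z =
       (real n3 + \<gamma>) *
       P6 (int n1) (int n2) (int n3 - 1) \<alpha> \<beta> \<gamma> (\<delta> + 1) a (b + 1) x y z \<and>
     O50 n1 n2 n3 \<alpha> \<beta> \<gamma> \<delta> a b u x y z =
       (real n3 + 1) *
       P6 (int n1) (int n2) (int n3 + 1) \<alpha> \<beta> (\<gamma> - 1) \<delta> a (b - 1) x y z \<and>
     O50_plus n1 n2 n3 \<alpha> \<beta> \<gamma> \<delta> a b u x y z =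
       (real n3 + \<delta>) *
       P6 (int n1) (int n2) (int n3 - 1) \<alpha> \<beta> (\<gamma> + 1) \<delta> a (b + 1) x y z \<and>
     O60 n1 n2 n3 \<alpha> \<beta> \<gamma> \<delta> a b u x y z =
       (real n3 + \<gamma>) *
       P6 (int n1) (int n2) (int n3) \<alpha> \<beta> (\<gamma> - 1) (\<delta> + 1) a b x y z \<and>
     O60_plus n1 n2 n3 \<alpha> \<beta> \<gamma> \<delta> a b u x y z =
       (real n3 + \<delta>) *
       P6 (int n1) (int n2) (int n3) \<alpha> \<beta> (\<gamma> + 1) (\<delta> - 1) a b x y z"
  by (intro conjI second_index_ladder[OF assms(4,3)] third_index_ladder[OF assms(4,3)]
      first_index_ladder[OF assms(4,3,1,2)])

end
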